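(* Let $s\ge1$ and $t\ge0$ be integers and let $\mathcal{S}_s=(\boldsymbol{x}_0,\boldsymbol{x}_1,\ldots)$ be an order $2$ digital $(t,s)$-sequence in $[0,1)^s$ over $\mathbb{F}_2$. For every even integer $q$ with $2\le q<\infty$ there is a constant $C>0$ depending only on $s$, $q$ and $t$ such that for all $N\ge2$ with dyadic expansion $N=2^{m_1}+2^{m_2}+\cdots+2^{m_r}$, $m_1>m_2>\cdots>m_r\ge0$, the first $N$ points $\mathcal{P}_{N,s}=\{\boldsymbol{x}_0,\ldots,\boldsymbol{x}_{N-1}\}$ satisfy $$\mathcal{L}_q(\mathcal{P}_{N,s})\le C\,\frac{r^{3/2-1/q}}{N}\sqrt{\sum_{v=1}^rm_v^{s-1}}.$$
   Context: $\mathcal{L}_q$ discrepancy: $\delta(P;\boldsymbol{\theta})=\frac1N\#\{n:\boldsymbol{x}_n\in\prod_{j=1}^s[0,\theta_j)\}-\prod_j\theta_j$ and $\mathcal{L}_q(P)=(\int_{[0,1]^s}|\delta(P;\boldsymbol{\theta})|^qd\boldsymbol{\theta})^{1/q}$; convention $0^0=1$. Digital sequences over $\mathbb{F}_2$ (identify $0,1\in\mathbb{F}_2$ with integers): generating matrices $C_j=(c_{j,k,\ell})_{k,\ell\ge1}\in\mathbb{F}_2^{\mathbb{N}\times\mathbb{N}}$, $1\le j\le s$, with the standing convention $c_{j,k,\ell}=0$ for $k>2\ell$; for $n=\sum_{i\ge0}n_i2^i$, $x_{j,n,k}=\sum_{\ell\ge1}n_{\ell-1}c_{j,k,\ell}$,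 $x_{j,n}=\sum_{k\ge1}x_{j,n,k}2^{-k}$, $\boldsymbol{x}_n=(x_{1,n},\ldots,x_{s,n})$. Order 2 digital net: for $m\ge1$, $0\le t\le2m$, matrices $C_1,\ldots,C_s\in\mathbb{F}_2^{2m\times m}$ with rows $c_{j,1},\ldots,c_{j,2m}$ generate an order $2$ digital $(t,m,s)$-net over $\mathbb{F}_2$ if for all choices of $\nu_j\ge0$ and indices $1\le i_{j,\nu_j}<\cdots<i_{j,1}\le2m$ ($1\le j\le s$) with $\sum_{j=1}^s\sum_{l=1}^{\min(\nu_j,2)}i_{j,l}\le2m-t$, the vectors $c_{j,i_{j,l}}$ ($1\le j\le s$, $1\le l\le\nu_j$) are linearly independent over $\mathbb{F}_2$. The digital sequence with matrices $C_1,\ldots,C_s\in\mathbb{F}_2^{\mathbb{N}\times\mathbb{N}}$ is an order $2$ digital $(t,s)$-sequence if for all $m>t/2$ the upper-left $2m\times m$ submatrices $C_1^{2m\times m},\ldots,C_s^{2m\times m}$ generate an order 2 digital $(t,m,s)$-net. *)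

theory Defs
  imports "HOL-Analysis.Analysis" "HOL-Library.Z2"
begin

text \<open>
  Coordinates are indexed by \<open>{1..s}\<close>. Points are functions \<open>nat \<Rightarrow> real\<close> whose values outside
  \<open>{1..s}\<close> are never inspected. A family of generating matrices is a function \<open>C\<close>, where
  \<open>C j k l\<close> is the entry in row \<open>k \<ge> 1\<close> and column \<open>l \<ge> 1\<close> of the \<open>j\<close>-th matrix.
\<close>

definition local_discrepancy :: "nat \<Rightarrow> nat \<Rightarrow> (nat \<Rightarrow> nat \<Rightarrow> real) \<Rightarrow> (nat \<Rightarrow> real) \<Rightarrow> real"
  where "local_discrepancy s N x \<theta> =
    real (card {n. n < N \<and> (\<forall>j\<in>{1..s}. x n j \<in> {0..<\<theta> j})}) / real N - (\<Prod>j\<in>{1..s}. \<theta> j)"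

definition Lq_discrepancy :: "nat \<Rightarrow> real \<Rightarrow> nat \<Rightarrow> (nat \<Rightarrow> nat \<Rightarrow> real) \<Rightarrow> real"
  where "Lq_discrepancy s q N x =
    (LINT \<theta>:(PiE {1..s} (\<lambda>_. {0..1}))|PiM {1..s} (\<lambda>_. lborel).
       \<bar>local_discrepancy s N x \<theta>\<bar> powr q) powr (1 / q)"

text \<open>
  The sum over \<open>l\<close> may stop at \<open>n\<close>: since \<open>n < 2 ^ n\<close>, the binary digits of \<open>n\<close> at positions
  \<open>l - 1 \<ge> n\<close> vanish.
\<close>

definition digital_digit :: "(nat \<Rightarrow> nat \<Rightarrow> nat \<Rightarrow> bit) \<Rightarrow> nat \<Rightarrow> nat \<Rightarrow> nat \<Rightarrow> bit"
  where "digital_digit C n j k = (\<Sum>l = 1..n. of_nat (n div 2 ^ (l - 1) mod 2) * C j k l)"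

definition digital_sequence :: "(nat \<Rightarrow> nat \<Rightarrow> nat \<Rightarrow> bit) \<Rightarrow> nat \<Rightarrow> nat \<Rightarrow> real"
  where "digital_sequence C n j = (\<Sum>k. of_bit (digital_digit C n j (Suc k)) / 2 ^ Suc k)"

text \<open>
  Linear independence over the two-element field of a finite family of vectors with coordinates
  indexed by \<open>{1..m}\<close>. It concerns the family, not the set of its members: equal vectors at
  different indices are dependent.
\<close>

definition lin_indep_family :: "nat \<Rightarrow> 'i set \<Rightarrow> ('i \<Rightarrow> nat \<Rightarrow> bit) \<Rightarrow> bool"
  where "lin_indep_family m I v \<longleftrightarrow>
    (\<forall>a :: 'i \<Rightarrow> bit. (\<forall>l\<in>{1..m}. (\<Sum>p\<in>I. a p * v p l) = 0) \<longrightarrow> (\<forall>p\<in>I. a p = 0))"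

text \<open>
  Only the entries \<open>C j k l\<close> with \<open>1 \<le> k \<le> 2 * m\<close> and \<open>1 \<le> l \<le> m\<close> are inspected, so for infinite
  matrices this is a statement about their upper-left \<open>2m \<times> m\<close> submatrices.
\<close>

definition order2_digital_net ::
    "nat \<Rightarrow> nat \<Rightarrow> nat \<Rightarrow> (nat \<Rightarrow> nat \<Rightarrow> nat \<Rightarrow> bit) \<Rightarrow> bool"
  where "order2_digital_net t m s C \<longleftrightarrow> m \<ge> 1 \<and> t \<le> 2 * m \<and>
    (\<forall>(\<nu> :: nat \<Rightarrow> nat) (i :: nat \<Rightarrow> nat \<Rightarrow> nat).
       (\<forall>j\<in>{1..s}. i j ` {1..\<nu> j} \<subseteq> {1..2 * m} \<and> strict_antimono_on {1..\<nu> j} (i j)) \<longrightarrow>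
       (\<Sum>j = 1..s. \<Sum>l = 1..min (\<nu> j) 2. i j l) \<le> 2 * m - t \<longrightarrow>
       lin_indep_family m (SIGMA j:{1..s}. {1..\<nu> j}) (\<lambda>(j, l). C j (i j l)))"

definition order2_digital_sequence ::
    "nat \<Rightarrow> nat \<Rightarrow> (nat \<Rightarrow> nat \<Rightarrow> nat \<Rightarrow> bit) \<Rightarrow> bool"
  where "order2_digital_sequence t s C \<longleftrightarrow>
    (\<forall>j\<in>{1..s}. \<forall>k\<ge>1. \<forall>l\<ge>1. k > 2 * l \<longrightarrow> C j k l = 0) \<and>
    (\<forall>m. real m > real t / 2 \<longrightarrow> order2_digital_net t m s C)"

end

theory Submission
  imports Defs
begin

text \<open>
  Split the first \<open>N\<close> points into \<open>r\<close> digitally shifted order 2 nets with \<open>2 ^ m v\<close> points. Minkowski's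
  and the Cauchy--Schwarz inequality reduce the theorem to \<open>\<parallel>D\<parallel>\<^sub>q \<le> K * m ^ ((s - 1) / 2)\<close> for the
  unnormalised discrepancy \<open>D\<close> of a single such net, even with \<open>r powr (1 / 2)\<close> instead of
  \<open>r powr (3 / 2 - 1 / q)\<close>. Rounding \<open>\<theta>\<close> up to a grid of mesh \<open>2 ^ - M\<close> with \<open>M = 2 * N\<close> costs at most
  \<open>s\<close> and makes everything finite.

  For one net, decompose \<open>D = (\<Sum>a. D a)\<close> over \<open>a \<in> {0..M}\<^sup>s\<close> into multi-parameter dyadic martingale
  differences. Flipping a digit of one coordinate fixes the coarser differences and negates the one at
  that level, so the two-point inequality gives \<open>\<parallel>D\<parallel>\<^sub>q\<^sup>2 \<le> K * (\<Sum>a. \<parallel>D a\<parallel>\<^sub>q\<^sup>2)\<close> coordinate by coordinate.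
  Each norm \<open>\<parallel>D a\<parallel>\<^sub>q\<close> decays geometrically in the distance between \<open>a 1 + \<dots> + a s\<close> and \<open>m\<close>, and there
  are at most \<open>(k + 1) ^ (s - 1)\<close> indices with \<open>a 1 + \<dots> + a s = k\<close>.
  For large \<open>a\<close> the decay comes from counting points in boxes. For small \<open>a\<close> it comes from the order 2
  property: as a function of a point, a Haar projection is constant on dyadic intervals up to a
  combination of Walsh functions of only two digits \<open>a\<close> and \<open>k\<close>, with coefficient about \<open>2 ^ (a - k)\<close>.
  Such a term integrates exactly over the net unless \<open>a + k\<close>, summed over the coordinates, exceeds \<open>2 * m - t\<close>.
\<close>

section \<open>Binary digits and equidistribution\<close>

definition bsgn :: "bit \<Rightarrow> real" where "bsgn b = (if b = 0 then 1 else -1)"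

lemma bsgn_simps [simp]: "bsgn 0 = 1" "bsgn 1 = -1"
  by (simp_all add: bsgn_def)

lemma bsgn_add: "bsgn (a + b) = bsgn a * bsgn b"
  by (cases a; cases b) simp_all

lemma bsgn_sum: "bsgn (\<Sum>x\<in>A. f x) = (\<Prod>x\<in>A. bsgn (f x))"
proof (induction A rule: infinite_finite_induct)
  case (insert x F)
  then show ?case by (simp only: sum.insert prod.insert bsgn_add not_False_eq_True)
qed simp_all

lemma abs_bsgn [simp]: "\<bar>bsgn b\<bar> = 1"
  by (cases b) simp_all

definition bin_digit :: "nat \<Rightarrow> nat \<Rightarrow> bit"
  where "bin_digit n l = of_nat (n div 2 ^ l mod 2)"

lemma bin_digit_add_top: "l < m \<Longrightarrow> bin_digit (2 ^ m * c + i) l = bin_digit i l"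
proof -
  assume "l < m"
  then obtain d where m: "m = Suc (l + d)"
    using less_imp_Suc_add by blast
  have "(2 ^ m * c + i) div 2 ^ l = 2 ^ Suc d * c + i div 2 ^ l"
  proof -
    have "2 ^ m * c = 2 ^ l * (2 ^ Suc d * c)" by (simp add: m power_add)
    then show ?thesis by (simp only: div_mult_self4) simp
  qed
  then show ?thesis by (simp add: bin_digit_def mod_mult_self4 mult.assoc)
qed

lemma bin_digit_top: "i < 2 ^ m \<Longrightarrow> bin_digit (2 ^ m + i) m = 1"
  by (simp add: bin_digit_def)

lemma bin_digit_less: "i < 2 ^ m \<Longrightarrow> m \<le> l \<Longrightarrow> bin_digit i l = 0"
  by (metis bin_digit_def div_less mod_0 of_nat_0 order_less_le_trans power_increasing one_le_numeral)

lemma sum_lessThan_add: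
  fixes f :: "nat \<Rightarrow> 'a::comm_monoid_add"
  shows "(\<Sum>i<a + b. f i) = (\<Sum>i<a. f i) + (\<Sum>i<b. f (a + i))"
  by (induction b) (simp_all add: add.assoc)

text \<open>The digits of \<open>i < 2 ^ m\<close> run through all \<open>m\<close>-tuples of bits
  exactly once, so the sum of products factorises. The induction splits the range by the top
  digit.\<close>

lemma sum_prod_bin_digit:
  fixes f :: "nat \<Rightarrow> bit \<Rightarrow> real"
  shows "(\<Sum>i<2 ^ m. \<Prod>l<m. f l (bin_digit i l)) = (\<Prod>l<m. f l 0 + f l 1)"
proof (induction m)
  case 0
  then show ?case by simp
next
  case (Suc m)
  have lo: "(\<Sum>i<2 ^ m. \<Prod>l<Suc m. f l (bin_digit i l)) =
      (\<Sum>i<2 ^ m. \<Prod>l<m. f l (bin_digit i l)) * f m 0"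
    by (simp add: sum_distrib_right bin_digit_less)
  have hi: "(\<Sum>i<2 ^ m. \<Prod>l<Suc m. f l (bin_digit (2 ^ m + i) l)) =
      (\<Sum>i<2 ^ m. \<Prod>l<m. f l (bin_digit i l)) * f m 1"
    unfolding sum_distrib_right
  proof (rule sum.cong[OF refl])
    fix i :: nat assume "i \<in> {..<2 ^ m}"
    then show "(\<Prod>l<Suc m. f l (bin_digit (2 ^ m + i) l)) = (\<Prod>l<m. f l (bin_digit i l)) * f m 1"
      using bin_digit_add_top[of _ m 1 i] bin_digit_top[of i m] by simp
  qed
  have "(\<Sum>i<2 ^ Suc m. \<Prod>l<Suc m. f l (bin_digit i l)) =
      (\<Sum>i<2 ^ m. \<Prod>l<Suc m. f l (bin_digit i l)) + (\<Sum>i<2 ^ m. \<Prod>l<Suc m. f l (bin_digit (2 ^ m + i) l))"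
    using sum_lessThan_add[of _ "2 ^ m" "2 ^ m"] by (simp only: power_Suc mult_2)
  then show ?case
    using Suc.IH lo hi by (simp add: algebra_simps)
qed

text \<open>Orthogonality of characters: after factorising over the digits, a position with
  \<open>w l = 1\<close> contributes the factor \<open>1 + (-1) = 0\<close>.\<close>

lemma character_sum:
  fixes w :: "nat \<Rightarrow> bit"
  assumes "\<exists>l\<in>{1..m}. w l \<noteq> 0"
  shows "(\<Sum>i<2 ^ m. bsgn (\<Sum>l = 1..m. bin_digit i (l - 1) * w l)) = 0"
proof -
  have "(\<Sum>l = 1..m. bin_digit i (l - 1) * w l) = (\<Sum>l<m. bin_digit i l * w (Suc l))" for i
    by (rule sum.reindex_bij_witness[of _ Suc "\<lambda>l. l - 1"]) auto
  then have "(\<Sum>i<2 ^ m. bsgn (\<Sum>l = 1..m. bin_digit i (l - 1) * w l)) =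
      (\<Sum>i<2 ^ m. \<Prod>l<m. bsgn (bin_digit i l * w (Suc l)))"
    by (simp only: bsgn_sum)
  also have "\<dots> = (\<Prod>l<m. 1 + bsgn (w (Suc l)))"
    using sum_prod_bin_digit[of "\<lambda>l b. bsgn (b * w (Suc l))" m]
    by (simp only: mult_zero_left mult_1_left bsgn_simps)
  also have "\<dots> = 0"
  proof -
    obtain l where "l \<in> {1..m}" "w l = 1" using assms by auto
    then have "l - 1 \<in> {..<m}" "1 + bsgn (w (Suc (l - 1))) = 0" by auto
    then show ?thesis by (meson finite_lessThan prod_zero)
  qed
  finally show ?thesis .
qed

text \<open>Independent linear forms take all bit patterns equally often. Each \<open>g p\<close> is
  its mean plus a multiple of the character \<open>bsgn\<close>; after multiplying out, every
  nonempty product of characters is the character of a nonzero combination of the \<open>v p\<close>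
  and sums to 0, so only the product of the means survives. The shift \<open>d\<close> affects only
  signs.\<close>

lemma equidistribution:
  fixes g :: "'i \<Rightarrow> bit \<Rightarrow> real"
  assumes ind: "lin_indep_family m I v" and fin: "finite I"
  shows "(\<Sum>i<2 ^ m. \<Prod>p\<in>I. g p (d p + (\<Sum>l = 1..m. bin_digit i (l - 1) * v p l))) =
    2 ^ m * (\<Prod>p\<in>I. (g p 0 + g p 1) / 2)"
proof -
  let ?L = "\<lambda>p i. \<Sum>l = 1..m. bin_digit i (l - 1) * v p l"
  let ?al = "\<lambda>p. (g p 0 + g p 1) / 2" and ?be = "\<lambda>p. (g p 0 - g p 1) / 2"
  have g: "g p b = ?be p * bsgn b + ?al p" for p b
    by (cases b) (auto simp: field_simps)
  have char: "(\<Sum>i<2 ^ m. \<Prod>p\<in>B. bsgn (?L p i)) = (if B = {} then 2 ^ m else 0)" if "B \<subseteq> I" for B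
  proof (cases "B = {}")
    case False
    have fB: "finite B" using fin that finite_subset by blast
    let ?w = "\<lambda>l. \<Sum>p\<in>B. v p l"
    have "(\<Prod>p\<in>B. bsgn (?L p i)) = bsgn (\<Sum>l = 1..m. bin_digit i (l - 1) * ?w l)" for i
      unfolding bsgn_sum[symmetric] by (subst sum.swap) (simp only: sum_distrib_left)
    \<comment> \<open>If \<open>?w\<close> vanished on \<open>{1..m}\<close>, the indicator of
      \<open>B\<close> would be a nontrivial relation among the \<open>v p\<close>.\<close>
    moreover have "\<exists>l\<in>{1..m}. ?w l \<noteq> 0"
    proof (rule ccontr)
      assume "\<not> ?thesis"
      then have *: "\<forall>l\<in>{1..m}. ?w l = 0" by blast
      have "\<forall>l\<in>{1..m}. (\<Sum>p\<in>I. of_bool (p \<in> B) * v p l) = 0"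
      proof
        fix l assume "l \<in> {1..m}"
        have "(\<Sum>p\<in>I. of_bool (p \<in> B) * v p l) = (\<Sum>p\<in>B. v p l)"
          using that fin by (intro sum.mono_neutral_cong_right) auto
        then show "(\<Sum>p\<in>I. of_bool (p \<in> B) * v p l) = 0" using * \<open>l \<in> {1..m}\<close> by simp
      qed
      then have "\<forall>p\<in>I. (of_bool (p \<in> B) :: bit) = 0"
        using ind unfolding lin_indep_family_def by (elim allE[of _ "\<lambda>p. of_bool (p \<in> B)"]) blast
      then show False using False that by auto
    qed
    ultimately show ?thesis using character_sum[of m ?w] False by simp
  qed simp
  have "(\<Sum>i<2 ^ m. \<Prod>p\<in>I. g p (d p + ?L p i)) =
      (\<Sum>i<2 ^ m. \<Prod>p\<in>I. (?be p * bsgn (d p)) * bsgn (?L p i) + ?al p)"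
    by (subst g) (simp only: bsgn_add mult.assoc times_divide_eq_left)
  also have "\<dots> = (\<Sum>i<2 ^ m. \<Sum>B\<in>Pow I. ((\<Prod>p\<in>B. ?be p * bsgn (d p)) * (\<Prod>p\<in>I - B. ?al p)) * (\<Prod>p\<in>B. bsgn (?L p i)))"
    by (subst prod_add[OF fin]) (simp only: prod.distrib mult_ac)
  also have "\<dots> = (\<Sum>B\<in>Pow I. ((\<Prod>p\<in>B. ?be p * bsgn (d p)) * (\<Prod>p\<in>I - B. ?al p)) * (\<Sum>i<2 ^ m. \<Prod>p\<in>B. bsgn (?L p i)))"
    by (subst sum.swap) (simp add: sum_distrib_left)
  also have "\<dots> = (\<Sum>B\<in>Pow I. if B = {} then ((\<Prod>p\<in>B. ?be p * bsgn (d p)) * (\<Prod>p\<in>I - B. ?al p)) * 2 ^ m else 0)"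
    by (intro sum.cong refl) (use char in auto)
  also have "\<dots> = 2 ^ m * (\<Prod>p\<in>I. ?al p)"
    using fin by (subst sum.delta) auto
  finally show ?thesis .
qed

section \<open>The order 2 condition for sets of rows\<close>

lemma lin_indep_family_reindex:
  assumes ind: "lin_indep_family m A v" and bij: "bij_betw h A B" and v: "\<And>p. p \<in> A \<Longrightarrow> v p = w (h p)"
  shows "lin_indep_family m B w"
  unfolding lin_indep_family_def
proof (intro allI impI ballI)
  fix a :: "'b \<Rightarrow> bit" and p
  assume a: "\<forall>l\<in>{1..m}. (\<Sum>p\<in>B. a p * w p l) = 0" and p: "p \<in> B"
  have "\<forall>l\<in>{1..m}. (\<Sum>p\<in>A. (a \<circ> h) p * v p l) = 0"
    using a by (simp add: sum.reindex_bij_betw[OF bij, symmetric] v)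
  then have "\<forall>p\<in>A. (a \<circ> h) p = 0"
    using ind unfolding lin_indep_family_def by blast
  moreover obtain p' where "p' \<in> A" "p = h p'" using bij p by (auto simp: bij_betw_def)
  ultimately show "a p = 0" by auto
qed

text \<open>The net definition enumerates rows in decreasing order and measures the two largest per
  coordinate. For a set of rows these are bounded by \<open>B j\<close> as soon as all single
  elements and all pairs of distinct elements are, which spares later arguments the
  enumeration.\<close>

lemma order2_lin_indep:
  assumes net: "order2_digital_net t m s C"
    and S: "\<And>j. j \<in> {1..s} \<Longrightarrow> S j \<subseteq> {1..2 * m}"
    and one: "\<And>j x. j \<in> {1..s} \<Longrightarrow> x \<in> S j \<Longrightarrow> x \<le> B j"
    and two: "\<And>j x y. j \<in> {1..s} \<Longrightarrow> x \<in> S j \<Longrightarrow> y \<in> S j \<Longrightarrow> x \<noteq> y \<Longrightarrow> x + y \<le> B j"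
    and le: "(\<Sum>j = 1..s. B j) + t \<le> 2 * m"
  shows "lin_indep_family m (SIGMA j:{1..s}. S j) (\<lambda>(j, k). C j k)"
proof -
  define \<nu> where "\<nu> j = card (S j)" for j
  \<comment> \<open>Reversing the sorted list gives the decreasing enumeration; \<open>l - 1\<close>
    because the indices in the net definition start at 1.\<close>
  define e where "e j l = rev (sorted_list_of_set (S j)) ! (l - 1)" for j l
  have fin: "finite (S j)" if "j \<in> {1..s}" for j using S[OF that] finite_subset by blast
  have anti: "strict_antimono_on {1..\<nu> j} (e j)" if "j \<in> {1..s}" for j
  proof (rule monotone_onI)
    fix x y assume xy: "x \<in> {1..\<nu> j}" "y \<in> {1..\<nu> j}" "x < y"
    let ?L = "sorted_list_of_set (S j)"
    have "length ?L = \<nu> j" by (simp add: \<nu>_def)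
    moreover have "sorted_wrt (<) ?L" by simp
    ultimately show "e j y < e j x"
      unfolding e_def using xy by (auto simp: rev_nth sorted_wrt_iff_nth_less)
  qed
  have img: "e j ` {1..\<nu> j} = S j" if "j \<in> {1..s}" for j
  proof -
    have "S j = set (rev (sorted_list_of_set (S j)))" using fin[OF that] by simp
    also have "\<dots> = (\<lambda>l. rev (sorted_list_of_set (S j)) ! l) ` {..<\<nu> j}"
      by (simp add: set_conv_nth \<nu>_def image_def lessThan_def) blast
    also have "{..<\<nu> j} = (\<lambda>l. l - 1) ` {1..\<nu> j}"
      by (auto simp: image_iff intro!: bexI[of _ "Suc _"])
    finally show ?thesis by (simp add: image_image e_def)
  qed
  have inj: "inj_on (e j) {1..\<nu> j}" if "j \<in> {1..s}" for j
    using anti[OF that] unfolding monotone_on_def inj_on_def by (metis less_irrefl linorder_neqE_nat)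
  have bound: "(\<Sum>l = 1..min (\<nu> j) 2. e j l) \<le> B j" if j: "j \<in> {1..s}" for j
  proof -
    consider "\<nu> j = 0" | "\<nu> j = 1" | "\<nu> j \<ge> 2" by linarith
    then show ?thesis
    proof cases
      case 2
      then show ?thesis using one[OF j, of "e j 1"] img[OF j] by auto
    next
      case 3
      then have m2: "min (\<nu> j) 2 = Suc (Suc 0)" by simp
      have "1 \<in> {1..\<nu> j}" "2 \<in> {1..\<nu> j}" using 3 by auto
      then have "e j 1 \<in> S j" "e j 2 \<in> S j" "e j 1 \<noteq> e j 2"
        using img[OF j] inj[OF j] by (blast, blast) (metis inj_on_eq_iff[OF inj[OF j]] \<open>1 \<in> {1..\<nu> j}\<close> \<open>2 \<in> {1..\<nu> j}\<close> one_eq_numeral_iff semiring_norm(85))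
      then show ?thesis using two[OF j] m2 by (simp add: numeral_2_eq_2)
    qed simp
  qed
  have "(\<Sum>j = 1..s. \<Sum>l = 1..min (\<nu> j) 2. e j l) \<le> 2 * m - t"
    using sum_mono[of "{1..s}" "\<lambda>j. \<Sum>l = 1..min (\<nu> j) 2. e j l" B] bound le by force
  moreover have "\<forall>j\<in>{1..s}. e j ` {1..\<nu> j} \<subseteq> {1..2 * m} \<and> strict_antimono_on {1..\<nu> j} (e j)"
    using anti img S by simp
  ultimately have "lin_indep_family m (SIGMA j:{1..s}. {1..\<nu> j}) (\<lambda>(j, l). C j (e j l))"
    using net unfolding order2_digital_net_def by blast
  moreover have "bij_betw (\<lambda>(j, l). (j, e j l)) (SIGMA j:{1..s}. {1..\<nu> j}) (SIGMA j:{1..s}. S j)"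
    unfolding bij_betw_def
  proof
    show "inj_on (\<lambda>(j, l). (j, e j l)) (SIGMA j:{1..s}. {1..\<nu> j})"
    proof (rule inj_onI)
      fix x y
      assume xy: "x \<in> (SIGMA j:{1..s}. {1..\<nu> j})" "y \<in> (SIGMA j:{1..s}. {1..\<nu> j})"
        "(\<lambda>(j, l). (j, e j l)) x = (\<lambda>(j, l). (j, e j l)) y"
      obtain j l j' l' where [simp]: "x = (j, l)" "y = (j', l')" by (cases x, cases y)
      have "j' = j" using xy(3) by simp
      moreover have "l = l'" using inj_onD[OF inj[of j], of l l'] xy calculation by simp
      ultimately show "x = y" by simp
    qed
    show "(\<lambda>(j, l). (j, e j l)) ` (SIGMA j:{1..s}. {1..\<nu> j}) = (SIGMA j:{1..s}. S j)"
    proof -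
      have "(\<lambda>(j, l). (j, e j l)) ` (SIGMA j:{1..s}. {1..\<nu> j}) = (SIGMA j:{1..s}. e j ` {1..\<nu> j})"
        by auto
      also have "\<dots> = (SIGMA j:{1..s}. S j)" by (rule Sigma_cong) (simp_all only: img)
      finally show ?thesis .
    qed
  qed
  ultimately show ?thesis
    by (rule lin_indep_family_reindex[where w = "\<lambda>(j, k). C j k"]) (simp add: split_beta)
qed

section \<open>Martingale inequalities on finite sets\<close>

lemma convex_pow_nonneg: "convex_on {0::real..} (\<lambda>x. x ^ n)"
proof (cases "even n")
  case True
  then show ?thesis by (intro convex_on_subset[OF convex_power_even]) auto
qed (rule convex_power_odd)

text \<open>The triangle inequality for the norm of exponent \<open>n\<close>, in a form without
  roots: write \<open>f + g\<close> as \<open>A + B\<close> times the convex combination of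
  \<open>f / A\<close> and \<open>g / B\<close> with weights \<open>A / (A + B)\<close> and
  \<open>B / (A + B)\<close>, and use convexity of the power pointwise.\<close>

lemma minkowski_pow:
  fixes f g :: "'a \<Rightarrow> real"
  assumes f: "\<And>u. u \<in> \<Omega> \<Longrightarrow> f u \<ge> 0" and g: "\<And>u. u \<in> \<Omega> \<Longrightarrow> g u \<ge> 0"
    and A: "A > 0" and B: "B > 0"
    and fA: "(\<Sum>u\<in>\<Omega>. f u ^ n) \<le> A ^ n * W" and gB: "(\<Sum>u\<in>\<Omega>. g u ^ n) \<le> B ^ n * W"
  shows "(\<Sum>u\<in>\<Omega>. (f u + g u) ^ n) \<le> (A + B) ^ n * W"
proof -
  let ?a = "A / (A + B)" and ?b = "B / (A + B)"
  have ab: "?a \<ge> 0" "?b \<ge> 0" "?a + ?b = 1" using A B by (auto simp: add_divide_distrib[symmetric])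
  have pw: "(f u + g u) ^ n \<le> (A + B) ^ n * (?a * (f u ^ n / A ^ n) + ?b * (g u ^ n / B ^ n))"
    if u: "u \<in> \<Omega>" for u
  proof -
    have "f u + g u = (A + B) * (?a * (f u / A) + ?b * (g u / B))"
    proof -
      have "(A + B) * ?a = A" "(A + B) * ?b = B" using A B by auto
      then have "(A + B) * (?a * (f u / A) + ?b * (g u / B)) = A * (f u / A) + B * (g u / B)"
        by (simp only: distrib_left mult.assoc[symmetric])
      then show ?thesis using A B by simp
    qed
    then have "(f u + g u) ^ n = (A + B) ^ n * (?a * (f u / A) + ?b * (g u / B)) ^ n"
      by (simp only: power_mult_distrib)
    also have "(?a * (f u / A) + ?b * (g u / B)) ^ n \<le> ?a * (f u / A) ^ n + ?b * (g u / B) ^ n"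
    proof -
      have "\<forall>x\<in>{0..}. \<forall>y\<in>{0..}. (?a * x + ?b * y) ^ n \<le> ?a * x ^ n + ?b * y ^ n"
        using convex_pow_nonneg[of n] ab unfolding convex_on_def real_scaleR_def by blast
      moreover have "f u / A \<in> {0..}" "g u / B \<in> {0..}" using A B f[OF u] g[OF u] by auto
      ultimately show ?thesis by blast
    qed
    finally show ?thesis using A B by (simp add: power_divide mult_left_mono)
  qed
  have "(\<Sum>u\<in>\<Omega>. (f u + g u) ^ n) \<le>
      (\<Sum>u\<in>\<Omega>. (A + B) ^ n * (?a * (f u ^ n / A ^ n) + ?b * (g u ^ n / B ^ n)))"
    by (rule sum_mono) (rule pw)
  also have "\<dots> = (A + B) ^ n * (?a * ((\<Sum>u\<in>\<Omega>. f u ^ n) / A ^ n) + ?b * ((\<Sum>u\<in>\<Omega>. g u ^ n) / B ^ n))"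
    by (simp only: sum.distrib sum_distrib_left[symmetric] sum_divide_distrib[symmetric])
  also have "\<dots> \<le> (A + B) ^ n * (?a * W + ?b * W)"
    using fA gB A B by (intro mult_left_mono add_mono) (auto simp: field_simps)
  also have "\<dots> = (A + B) ^ n * W"
    using ab(3) by (simp only: distrib_right[symmetric] mult_1_left)
  finally show ?thesis .
qed

lemma minkowski_pow_sum:
  fixes f :: "'i \<Rightarrow> 'a \<Rightarrow> real"
  assumes "finite I" "I \<noteq> {}"
    and "\<And>i u. i \<in> I \<Longrightarrow> u \<in> \<Omega> \<Longrightarrow> f i u \<ge> 0" and "\<And>i. i \<in> I \<Longrightarrow> A i > 0"
    and "\<And>i. i \<in> I \<Longrightarrow> (\<Sum>u\<in>\<Omega>. f i u ^ n) \<le> A i ^ n * W"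
  shows "(\<Sum>u\<in>\<Omega>. (\<Sum>i\<in>I. f i u) ^ n) \<le> (\<Sum>i\<in>I. A i) ^ n * W"
  using assms
proof (induction I rule: finite_ne_induct)
  case (insert i I)
  have "(\<Sum>u\<in>\<Omega>. (f i u + (\<Sum>i\<in>I. f i u)) ^ n) \<le> (A i + (\<Sum>i\<in>I. A i)) ^ n * W"
    using insert by (intro minkowski_pow) (auto intro!: sum_nonneg sum_pos)
  then show ?case using insert by simp
qed simp

text \<open>In the binomial expansions the odd powers of \<open>y\<close> cancel. The remaining
  terms are compared one by one with the expansion of the right-hand side, which reduces to a crude
  comparison of \<open>2 * p choose (2 * i)\<close> with
  \<open>(p choose i) * (2 * p) ^ (2 * i)\<close>.\<close>

lemma two_point_inequality:
  fixes x y :: real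
  shows "((x + y) ^ (2 * p) + (x - y) ^ (2 * p)) / 2 \<le> (x\<^sup>2 + 4 * real p ^ 2 * y\<^sup>2) ^ p"
proof -
  let ?c = "\<lambda>k. real (2 * p choose k) * y ^ k * x ^ (2 * p - k)"
  have "(x + y) ^ (2 * p) = (\<Sum>k\<le>2 * p. ?c k)"
    by (subst add.commute) (rule binomial_ring)
  moreover have "(x - y) ^ (2 * p) = (\<Sum>k\<le>2 * p. (- 1) ^ k * ?c k)"
    using binomial_ring[of "- y" x "2 * p"] by (simp add: power_minus[of y] mult_ac)
  ultimately have "((x + y) ^ (2 * p) + (x - y) ^ (2 * p)) / 2 = (\<Sum>k\<le>2 * p. (1 + (- 1) ^ k) / 2 * ?c k)"
    by (simp add: sum.distrib sum_divide_distrib add_divide_distrib distrib_right)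
  also have "\<dots> = (\<Sum>k\<in>(\<lambda>i. 2 * i) ` {..p}. ?c k)"
  proof (rule sum.mono_neutral_cong_right)
    show "\<forall>k\<in>{..2 * p} - (\<lambda>i. 2 * i) ` {..p}. (1 + (- 1) ^ k) / 2 * ?c k = 0"
    proof
      fix k assume k: "k \<in> {..2 * p} - (\<lambda>i. 2 * i) ` {..p}"
      have "odd k"
      proof
        assume "even k"
        then have "k = 2 * (k div 2)" "k div 2 \<le> p" using k by auto
        then show False using k by blast
      qed
      then show "(1 + (- 1) ^ k) / 2 * ?c k = 0" by simp
    qed
  qed auto
  also have "\<dots> = (\<Sum>i\<le>p. ?c (2 * i))"
    by (subst sum.reindex) (auto simp: inj_on_def)
  also have "\<dots> \<le> (\<Sum>i\<le>p. real (p choose i) * (4 * real p ^ 2 * y\<^sup>2) ^ i * (x\<^sup>2) ^ (p - i))"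
  proof (rule sum_mono)
    fix i assume "i \<in> {..p}"
    then have i: "i \<le> p" by simp
    have "(2 * p choose (2 * i)) * 1 \<le> (2 * p choose (2 * i)) * fact (2 * i)"
      by (intro mult_left_mono) (auto simp: Suc_leI)
    also have "\<dots> \<le> (2 * p) ^ (2 * i)" by (rule binomial_fact_pow)
    also have "\<dots> \<le> (p choose i) * (2 * p) ^ (2 * i)"
      using i by (simp add: Suc_leI)
    finally have "real (2 * p choose (2 * i)) \<le> real ((p choose i) * (2 * p) ^ (2 * i))"
      by (simp only: of_nat_le_iff mult_1_right)
    also have "\<dots> = real (p choose i) * (4 * real p ^ 2) ^ i"
      by (simp add: power_mult power_mult_distrib)
    finally have "real (2 * p choose (2 * i)) * ((y\<^sup>2) ^ i * (x\<^sup>2) ^ (p - i)) \<le>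
        real (p choose i) * (4 * real p ^ 2) ^ i * ((y\<^sup>2) ^ i * (x\<^sup>2) ^ (p - i))"
      by (rule mult_right_mono) simp
    moreover have "2 * p - 2 * i = 2 * (p - i)" by simp
    ultimately show "?c (2 * i) \<le> real (p choose i) * (4 * real p ^ 2 * y\<^sup>2) ^ i * (x\<^sup>2) ^ (p - i)"
      by (simp only: power_mult power_mult_distrib mult.assoc)
  qed
  also have "\<dots> = (4 * real p ^ 2 * y\<^sup>2 + x\<^sup>2) ^ p"
    by (rule binomial_ring[symmetric])
  finally show ?thesis by (simp add: add.commute)
qed

text \<open>
  \<open>pnorm_le p \<Omega> f A\<close> says that \<open>\<parallel>f\<parallel>\<^sup>2 \<le> A\<close> for the norm of \<open>L\<^sub>2\<^sub>p\<close> with respect to the uniform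
  distribution on \<open>\<Omega>\<close>.
\<close>

definition pnorm_le :: "nat \<Rightarrow> 'a set \<Rightarrow> ('a \<Rightarrow> real) \<Rightarrow> real \<Rightarrow> bool"
  where "pnorm_le p \<Omega> f A \<longleftrightarrow> A > 0 \<and> (\<Sum>u\<in>\<Omega>. f u ^ (2 * p)) \<le> A ^ p * real (card \<Omega>)"

text \<open>Replacing \<open>u\<close> by \<open>T u\<close> shows that \<open>f + d\<close> and
  \<open>f - d\<close> have the same moment of order \<open>2 * p\<close>. Averaging the two allows
  the two-point inequality pointwise, and Minkowski with exponent \<open>p\<close> separates the
  squares of \<open>f\<close> and \<open>d\<close>. The coefficient of \<open>A\<close> stays 1, so
  iteration does not lose a factor at each step.\<close>

lemma pnorm_le_add_antisymmetric:
  assumes p: "p \<ge> 1" and T: "bij_betw T \<Omega> \<Omega>"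
    and fT: "\<And>u. u \<in> \<Omega> \<Longrightarrow> f (T u) = f u" and dT: "\<And>u. u \<in> \<Omega> \<Longrightarrow> d (T u) = - d u"
    and f: "pnorm_le p \<Omega> f A" and d: "pnorm_le p \<Omega> d B"
  shows "pnorm_le p \<Omega> (\<lambda>u. f u + d u) (A + 4 * real p ^ 2 * B)"
proof -
  let ?k = "4 * real p ^ 2"
  have k: "?k > 0" using p by simp
  have "(\<Sum>u\<in>\<Omega>. (f u + d u) ^ (2 * p)) = (\<Sum>u\<in>\<Omega>. (f (T u) + d (T u)) ^ (2 * p))"
    by (rule sum.reindex_bij_betw[OF T, symmetric])
  also have "\<dots> = (\<Sum>u\<in>\<Omega>. (f u - d u) ^ (2 * p))"
    by (rule sum.cong) (auto simp: fT dT)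
  finally have "(\<Sum>u\<in>\<Omega>. (f u + d u) ^ (2 * p)) =
      (\<Sum>u\<in>\<Omega>. ((f u + d u) ^ (2 * p) + (f u - d u) ^ (2 * p)) / 2)"
    by (simp add: sum.distrib sum_divide_distrib[symmetric])
  also have "\<dots> \<le> (\<Sum>u\<in>\<Omega>. ((f u)\<^sup>2 + ?k * (d u)\<^sup>2) ^ p)"
    by (intro sum_mono two_point_inequality)
  also have "\<dots> \<le> (A + ?k * B) ^ p * real (card \<Omega>)"
  proof (rule minkowski_pow)
    show "(\<Sum>u\<in>\<Omega>. ((f u)\<^sup>2) ^ p) \<le> A ^ p * real (card \<Omega>)"
      using f by (simp add: pnorm_le_def power_mult)
    have "(\<Sum>u\<in>\<Omega>. (?k * (d u)\<^sup>2) ^ p) = ?k ^ p * (\<Sum>u\<in>\<Omega>. d u ^ (2 * p))"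
      by (simp add: power_mult power_mult_distrib sum_distrib_left mult.assoc)
    also have "\<dots> \<le> ?k ^ p * (B ^ p * real (card \<Omega>))"
      using d k by (intro mult_left_mono) (auto simp: pnorm_le_def)
    finally show "(\<Sum>u\<in>\<Omega>. (?k * (d u)\<^sup>2) ^ p) \<le> (?k * B) ^ p * real (card \<Omega>)"
      by (simp add: power_mult_distrib mult.assoc)
  qed (use f d k in \<open>auto simp: pnorm_le_def\<close>)
  finally show ?thesis
    using f d k by (auto simp: pnorm_le_def intro!: add_pos_pos)
qed

text \<open>A square function estimate: the differences are added from coarse to fine, and
  \<open>T c\<close> fixes the partial sum of all levels below \<open>c\<close> while negating level
  \<open>c\<close>. The constant does not depend on the number of levels.\<close>

lemma pnorm_le_martingale:
  fixes f :: "nat \<Rightarrow> 'a \<Rightarrow> real"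
  assumes p: "p \<ge> 1"
    and T: "\<And>c. 1 \<le> c \<Longrightarrow> c \<le> M \<Longrightarrow> bij_betw (T c) \<Omega> \<Omega>"
    and inv: "\<And>b c u. b < c \<Longrightarrow> c \<le> M \<Longrightarrow> u \<in> \<Omega> \<Longrightarrow> f b (T c u) = f b u"
    and anti: "\<And>c u. 1 \<le> c \<Longrightarrow> c \<le> M \<Longrightarrow> u \<in> \<Omega> \<Longrightarrow> f c (T c u) = - f c u"
    and f: "\<And>c. c \<le> M \<Longrightarrow> pnorm_le p \<Omega> (f c) (A c)"
  shows "pnorm_le p \<Omega> (\<lambda>u. \<Sum>c\<le>M. f c u) (4 * real p ^ 2 * (\<Sum>c\<le>M. A c))"
proof -
  let ?k = "4 * real p ^ 2"
  have k: "1 \<le> ?k" using p one_le_power[of "real p" 2] by linarith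
  have Apos: "A c > 0" if "c \<le> M" for c using f[OF that] by (simp add: pnorm_le_def)
  \<comment> \<open>Level 0 has no antisymmetry; it is the start of the induction and enters with
    factor 1.\<close>
  have "pnorm_le p \<Omega> (\<lambda>u. \<Sum>c\<le>n. f c u) (A 0 + ?k * (\<Sum>c=1..n. A c))" if "n \<le> M" for n
    using that
  proof (induction n)
    case 0
    then show ?case using f[of 0] by simp
  next
    case (Suc n)
    have "pnorm_le p \<Omega> (\<lambda>u. (\<Sum>c\<le>n. f c u) + f (Suc n) u) (A 0 + ?k * (\<Sum>c=1..n. A c) + ?k * A (Suc n))"
    proof (rule pnorm_le_add_antisymmetric[OF p, of "T (Suc n)"])
      show "bij_betw (T (Suc n)) \<Omega> \<Omega>" using T Suc.prems by simp
      show "(\<Sum>c\<le>n. f c (T (Suc n) u)) = (\<Sum>c\<le>n. f c u)" if "u \<in> \<Omega>" for u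
        using inv Suc.prems that by (intro sum.cong) auto
    qed (use Suc f anti in auto)
    then show ?case by (simp add: algebra_simps)
  qed
  from this[of M] have *: "pnorm_le p \<Omega> (\<lambda>u. \<Sum>c\<le>M. f c u) (A 0 + ?k * (\<Sum>c=1..M. A c))" by simp
  have "(\<Sum>c\<le>M. A c) = A 0 + (\<Sum>c=1..M. A c)"
    by (simp add: atMost_atLeast0 sum.atLeast_Suc_atMost)
  then have le: "A 0 + ?k * (\<Sum>c=1..M. A c) \<le> ?k * (\<Sum>c\<le>M. A c)"
    using k Apos[of 0] mult_right_mono[of 1 ?k "A 0"] by (simp add: distrib_left)
  from * have "A 0 + ?k * (\<Sum>c=1..M. A c) > 0" by (simp add: pnorm_le_def)
  then have "(A 0 + ?k * (\<Sum>c=1..M. A c)) ^ p * real (card \<Omega>) \<le> (?k * (\<Sum>c\<le>M. A c)) ^ p * real (card \<Omega>)"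
    using le by (intro mult_right_mono power_mono) auto
  then show ?thesis
    using * le unfolding pnorm_le_def by linarith
qed

lemma sum_PiE_insert:
  assumes "j \<notin> J" "finite J" "finite B"
  shows "(\<Sum>a\<in>PiE (insert j J) (\<lambda>_. B). F a) = (\<Sum>c\<in>B. \<Sum>a\<in>PiE J (\<lambda>_. B). F (a(j := c)))"
proof -
  have "(\<Sum>a\<in>PiE (insert j J) (\<lambda>_. B). F a) = (\<Sum>x\<in>B \<times> PiE J (\<lambda>_. B). F ((\<lambda>(y, g). g(j := y)) x))"
    unfolding PiE_insert_eq using inj_combinator[OF assms(1), of "\<lambda>_. B"] by (subst sum.reindex) auto
  also have "\<dots> = (\<Sum>c\<in>B. \<Sum>a\<in>PiE J (\<lambda>_. B). F (a(j := c)))"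
    by (subst sum.cartesian_product) (simp add: split_beta)
  finally show ?thesis .
qed

text \<open>Induction over the coordinates: for a fixed level \<open>c\<close> in coordinate
  \<open>j\<close>, the sum over the levels of the other coordinates inherits the behaviour of its
  summands under \<open>T j\<close>, so the one-parameter estimate applies to it. Every coordinate
  costs a factor \<open>4 * real p ^ 2\<close>.\<close>

lemma pnorm_le_multi_martingale:
  fixes G :: "('i \<Rightarrow> nat) \<Rightarrow> 'a \<Rightarrow> real"
  assumes p: "p \<ge> 1" and I: "finite I"
    and T: "\<And>j c. j \<in> I \<Longrightarrow> 1 \<le> c \<Longrightarrow> c \<le> M \<Longrightarrow> bij_betw (T j c) \<Omega> \<Omega>"
    and inv: "\<And>a j c u. j \<in> I \<Longrightarrow> a j < c \<Longrightarrow> c \<le> M \<Longrightarrow> u \<in> \<Omega> \<Longrightarrow> G a (T j c u) = G a u"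
    and anti: "\<And>a j u. j \<in> I \<Longrightarrow> 1 \<le> a j \<Longrightarrow> a j \<le> M \<Longrightarrow> u \<in> \<Omega> \<Longrightarrow> G a (T j (a j) u) = - G a u"
    and G: "\<And>a. (\<And>j. j \<in> I \<Longrightarrow> a j \<le> M) \<Longrightarrow> pnorm_le p \<Omega> (G a) (A a)"
  shows "pnorm_le p \<Omega> (\<lambda>u. \<Sum>a\<in>PiE I (\<lambda>_. {..M}). G a u)
    ((4 * real p ^ 2) ^ card I * (\<Sum>a\<in>PiE I (\<lambda>_. {..M}). A a))"
proof -
  let ?k = "4 * real p ^ 2"
  define ov where "ov J a b = (\<lambda>j. if j \<in> J then a j else b j)" for J and a b :: "'i \<Rightarrow> nat"
  have "finite J \<Longrightarrow> J \<subseteq> I \<Longrightarrow> (\<And>j. j \<in> I - J \<Longrightarrow> b j \<le> M) \<Longrightarrow>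
    pnorm_le p \<Omega> (\<lambda>u. \<Sum>a\<in>PiE J (\<lambda>_. {..M}). G (ov J a b) u)
      (?k ^ card J * (\<Sum>a\<in>PiE J (\<lambda>_. {..M}). A (ov J a b)))" for J b
  proof (induction J arbitrary: b rule: finite_induct)
    case empty
    have "ov {} a b = b" for a by (simp add: ov_def)
    then show ?case using G[of b] empty by simp
  next
    case (insert j J)
    have ov: "ov (insert j J) (a(j := c)) b = ov J a (b(j := c))" for a c
      using insert.hyps by (auto simp: ov_def)
    have ovj: "ov J a (b(j := c)) j = c" for a c
      using insert.hyps by (auto simp: ov_def)
    have j: "j \<in> I" using insert.prems by auto
    have "pnorm_le p \<Omega> (\<lambda>u. \<Sum>c\<le>M. \<Sum>a\<in>PiE J (\<lambda>_. {..M}). G (ov J a (b(j := c))) u)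
      (?k * (\<Sum>c\<le>M. ?k ^ card J * (\<Sum>a\<in>PiE J (\<lambda>_. {..M}). A (ov J a (b(j := c))))))"
    proof (rule pnorm_le_martingale[OF p, of _ "T j"])
      show "pnorm_le p \<Omega> (\<lambda>u. \<Sum>a\<in>PiE J (\<lambda>_. {..M}). G (ov J a (b(j := c))) u)
        (?k ^ card J * (\<Sum>a\<in>PiE J (\<lambda>_. {..M}). A (ov J a (b(j := c)))))" if "c \<le> M" for c
        using that insert.prems by (intro insert.IH) auto
      show "(\<Sum>a\<in>PiE J (\<lambda>_. {..M}). G (ov J a (b(j := c))) (T j c u)) =
        - (\<Sum>a\<in>PiE J (\<lambda>_. {..M}). G (ov J a (b(j := c))) u)" if "1 \<le> c" "c \<le> M" "u \<in> \<Omega>" for c u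
        unfolding sum_negf[symmetric] using anti[OF j, of "ov J _ (b(j := c))"] that by (simp add: ovj)
    qed (use T[OF j] inv[OF j] in \<open>auto simp: ovj\<close>)
    then show ?case
      using insert.hyps
      by (subst (1 2) sum_PiE_insert) (simp_all add: ov sum_distrib_left mult.assoc)
  qed
  from this[OF I subset_refl, of "\<lambda>_. undefined"]
  have "pnorm_le p \<Omega> (\<lambda>u. \<Sum>a\<in>PiE I (\<lambda>_. {..M}). G (ov I a (\<lambda>_. undefined)) u)
      (?k ^ card I * (\<Sum>a\<in>PiE I (\<lambda>_. {..M}). A (ov I a (\<lambda>_. undefined))))" by simp
  moreover have "ov I a (\<lambda>_. undefined) = a" if "a \<in> PiE I (\<lambda>_. {..M})" for a
    using that by (auto simp: ov_def PiE_def extensional_def)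
  ultimately show ?thesis by simp
qed

section \<open>Haar projections and their Walsh expansions\<close>

text \<open>The grid point \<open>y / 2 ^ M\<close> has binary digits \<open>gbit M y 1, \<dots>, gbit M y M\<close>, most significant first.\<close>

definition gbit :: "nat \<Rightarrow> nat \<Rightarrow> nat \<Rightarrow> bit"
  where "gbit M y i = bin_digit y (M - i)"

lemma bsgn_bin_digit: "bsgn (bin_digit y h) = (if even (y div 2 ^ h) then 1 else - 1)"
  by (simp add: bin_digit_def mod2_eq_if)

lemma bin_digit_eq_iff: "bin_digit y h = bin_digit u h' \<longleftrightarrow> (even (y div 2 ^ h) \<longleftrightarrow> even (u div 2 ^ h'))"
  by (simp add: bin_digit_def mod2_eq_if)

text \<open>Flips the binary digit of \<open>u\<close> of weight \<open>2 ^ h\<close>, that is,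
  exchanges the two halves of a dyadic cell of \<open>2 ^ Suc h\<close> grid points.\<close>

definition cell_flip :: "nat \<Rightarrow> nat \<Rightarrow> nat"
  where "cell_flip h u = (if even (u div 2 ^ h) then u + 2 ^ h else u - 2 ^ h)"

lemma cell_flip_div: "cell_flip h u div 2 ^ h = (if even (u div 2 ^ h) then u div 2 ^ h + 1 else u div 2 ^ h - 1)"
proof (cases "even (u div 2 ^ h)")
  case False
  then have "u \<ge> 2 ^ h" by (metis div_less even_zero not_le)
  then show ?thesis using False by (simp add: cell_flip_def le_div_geq)
qed (simp add: cell_flip_def)

lemma cell_flip_div_Suc: "cell_flip h u div 2 ^ Suc h = u div 2 ^ Suc h"
proof -
  have "cell_flip h u div 2 ^ Suc h = cell_flip h u div 2 ^ h div 2" for u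
    by (metis div_mult2_eq power_Suc2)
  moreover have "u div 2 ^ Suc h = u div 2 ^ h div 2"
    by (metis div_mult2_eq power_Suc2)
  ultimately show ?thesis by (auto simp: cell_flip_div elim!: evenE oddE)
qed

lemma cell_flip_div_higher: "h < h' \<Longrightarrow> cell_flip h u div 2 ^ h' = u div 2 ^ h'"
proof -
  assume "h < h'"
  then obtain d where "h' = Suc h + d" using less_iff_Suc_add by auto
  then show ?thesis by (simp only: power_add div_mult2_eq cell_flip_div_Suc)
qed

lemma cell_flip_cell_flip: "cell_flip h (cell_flip h u) = u"
proof (cases "even (u div 2 ^ h)")
  case True
  then show ?thesis using cell_flip_div[of h u] by (simp add: cell_flip_def)
next
  case False
  then have "u \<ge> 2 ^ h" by (metis div_less even_zero not_le)
  then show ?thesis using False cell_flip_div[of h u] by (simp add: cell_flip_def)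
qed

lemma cell_flip_less: "h < M \<Longrightarrow> u < 2 ^ M \<Longrightarrow> cell_flip h u < 2 ^ M"
  by (metis cell_flip_div_higher div_eq_0_iff power_not_zero zero_neq_numeral)

text \<open>
  \<open>lev M a y u\<close> is the conditional expectation of the indicator of \<open>y \<le> u\<close>, as a function of
  \<open>u \<in> {..<2 ^ M}\<close>, given the \<open>a\<close> leading binary digits of \<open>u\<close>, and \<open>wav M a\<close> is the corresponding
  martingale difference (a Haar projection).
\<close>

definition lev :: "nat \<Rightarrow> nat \<Rightarrow> nat \<Rightarrow> nat \<Rightarrow> real"
  where "lev M a y u =
    (if y div 2 ^ (M - a) < u div 2 ^ (M - a) then 1
     else if u div 2 ^ (M - a) < y div 2 ^ (M - a) then 0
     else 1 - real (y mod 2 ^ (M - a)) / 2 ^ (M - a))"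

definition wav :: "nat \<Rightarrow> nat \<Rightarrow> nat \<Rightarrow> nat \<Rightarrow> real"
  where "wav M a y u = lev M a y u - (if a = 0 then 0 else lev M (a - 1) y u)"

text \<open>Telescoping; at level \<open>M\<close> the cells are single points and
  \<open>lev\<close> is the indicator itself.\<close>

lemma sum_wav: "(\<Sum>a\<le>M. wav M a y u) = of_bool (y \<le> u)"
proof -
  have "(\<Sum>a\<le>n. wav M a y u) = lev M n y u" for n
    by (induction n) (simp_all add: wav_def)
  then show ?thesis by (auto simp: lev_def)
qed

text \<open>\<open>Y\<close> and \<open>U\<close> are the cells of \<open>y\<close> and
  \<open>u\<close> at the finer level, \<open>Y div 2\<close> and \<open>U div 2\<close> their
  parents, and \<open>w\<close> is the relative position of \<open>y\<close> inside
  \<open>Y\<close>. With distinct parents both levels give the same value; a common parent leaves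
  four cases for the last bits.\<close>

lemma haar_step:
  fixes Y U :: nat and w :: real
  shows "(if Y < U then 1 else if U < Y then 0 else 1 - w) -
      (if Y div 2 < U div 2 then 1 else if U div 2 < Y div 2 then 0 else 1 - real (Y mod 2) / 2 - w / 2) =
    (if Y div 2 = U div 2
     then - (if even U then 1 else - 1) * (1 / 4 + (if even Y then 1 else - 1) * (w - 1 / 2) / 2) else 0)"
proof -
  obtain c b d e where Y: "Y = 2 * c + b" "b = 0 \<or> b = 1" and U: "U = 2 * d + e" "e = 0 \<or> e = 1"
    by (metis mod2_eq_if mult_div_mod_eq)
  show ?thesis
    using Y(2) U(2) unfolding Y(1) U(1)
    by (elim disjE; cases c d rule: linorder_cases) (simp_all add: mod2_eq_if field_simps)
qed

text \<open>In \<open>u\<close> this is a Haar function. Its coefficient is, up to sign, a hat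
  function of \<open>y\<close>: it equals \<open>w / 2\<close> on the left half of the cell and
  \<open>(1 - w) / 2\<close> on the right half. The form with \<open>1 / 4\<close> and a sign times
  \<open>w - 1 / 2\<close> prepares the Walsh expansion.\<close>

lemma wav_pos:
  fixes y u :: nat
  assumes "1 \<le> a" "a \<le> M"
  defines "h \<equiv> M - a"
  defines "w \<equiv> real (y mod 2 ^ h) / 2 ^ h"
  shows "wav M a y u =
    (if y div 2 ^ Suc h = u div 2 ^ Suc h
     then - bsgn (bin_digit u h) * (1 / 4 + bsgn (bin_digit y h) * (w - 1 / 2) / 2) else 0)"
proof -
  define Y U where "Y = y div 2 ^ h" and "U = u div 2 ^ h"
  have h: "M - (a - 1) = Suc h" using assms by auto
  have Y2: "y div 2 ^ Suc h = Y div 2" and U2: "u div 2 ^ Suc h = U div 2"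
    by (simp_all only: Y_def U_def div_mult2_eq power_Suc2)
  have "y mod 2 ^ Suc h = 2 ^ h * (Y mod 2) + y mod 2 ^ h"
    unfolding Y_def power_Suc2 by (rule mod_mult2_eq)
  then have m: "real (y mod 2 ^ Suc h) / 2 ^ Suc h = real (Y mod 2) / 2 + w / 2"
    by (simp add: w_def field_simps)
  have L1: "lev M a y u = (if Y < U then 1 else if U < Y then 0 else 1 - w)"
    by (simp add: lev_def Y_def U_def w_def h_def)
  have L0: "lev M (a - 1) y u =
      (if Y div 2 < U div 2 then 1 else if U div 2 < Y div 2 then 0 else 1 - real (Y mod 2) / 2 - w / 2)"
    unfolding lev_def h Y2 U2 m by simp
  have wav: "wav M a y u = lev M a y u - lev M (a - 1) y u" using assms by (simp add: wav_def)
  show ?thesis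
    unfolding wav L0 L1 Y2 U2 bsgn_bin_digit Y_def[symmetric] U_def[symmetric] by (rule haar_step)
qed

lemma wav_flip_lower: "a < c \<Longrightarrow> c \<le> M \<Longrightarrow> wav M a y (cell_flip (M - c) u) = wav M a y u"
  unfolding wav_def lev_def by (simp add: cell_flip_div_higher)

lemma wav_flip:
  assumes "1 \<le> c" "c \<le> M"
  shows "wav M c y (cell_flip (M - c) u) = - wav M c y u"
proof -
  have "bsgn (bin_digit (cell_flip (M - c) u) (M - c)) = - bsgn (bin_digit u (M - c))"
    by (auto simp: bsgn_bin_digit cell_flip_div)
  then show ?thesis using assms by (simp only: wav_pos cell_flip_div_Suc) simp
qed

text \<open>The left side is the binary fraction formed by the digits of \<open>y\<close> after
  position \<open>a\<close>, and a bit \<open>b\<close> has the value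
  \<open>(1 - bsgn b) / 2\<close>. The constant is the sum of \<open>1 / 2 ^ (k - a + 1)\<close>
  over \<open>a < k <= M\<close>.\<close>

lemma mod_walsh_expansion:
  assumes "a \<le> M"
  shows "real (y mod 2 ^ (M - a)) / 2 ^ (M - a) =
    1 / 2 - 1 / 2 ^ (M - a + 1) - (\<Sum>k\<in>{a<..M}. bsgn (gbit M y k) / 2 ^ (k - a + 1))"
  using assms
proof (induction rule: inc_induct)
  case (step a)
  define h where "h = M - Suc a"
  have h: "M - a = Suc h" using step by (simp add: h_def)
  have "y mod 2 ^ Suc h = 2 ^ h * (y div 2 ^ h mod 2) + y mod 2 ^ h"
    unfolding power_Suc2 by (rule mod_mult2_eq)
  moreover have "real (y div 2 ^ h mod 2) = (1 - bsgn (bin_digit y h)) / 2"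
    by (auto simp: bsgn_bin_digit even_iff_mod_2_eq_zero)
  ultimately have "real (y mod 2 ^ Suc h) / 2 ^ Suc h = (1 - bsgn (bin_digit y h)) / 4 + (real (y mod 2 ^ h) / 2 ^ h) / 2"
    by (simp add: add_divide_distrib mult.commute)
  also have "real (y mod 2 ^ h) / 2 ^ h = 1 / 2 - 1 / 2 ^ (h + 1) - (\<Sum>k\<in>{Suc a<..M}. bsgn (gbit M y k) / 2 ^ (k - Suc a + 1))"
    using step.IH by (simp add: h_def)
  also have "(\<Sum>k\<in>{Suc a<..M}. bsgn (gbit M y k) / 2 ^ (k - Suc a + 1)) = 2 * (\<Sum>k\<in>{Suc a<..M}. bsgn (gbit M y k) / 2 ^ (k - a + 1))"
    unfolding sum_distrib_left
  proof (rule sum.cong[OF refl])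
    fix k assume "k \<in> {Suc a<..M}"
    then have "k - a = Suc (k - Suc a)" by auto
    then show "bsgn (gbit M y k) / 2 ^ (k - Suc a + 1) = 2 * (bsgn (gbit M y k) / 2 ^ (k - a + 1))" by simp
  qed
  finally have e: "real (y mod 2 ^ Suc h) / 2 ^ Suc h = (1 - bsgn (bin_digit y h)) / 4 +
    (1 / 2 - 1 / 2 ^ (h + 1) - 2 * (\<Sum>k\<in>{Suc a<..M}. bsgn (gbit M y k) / 2 ^ (k - a + 1))) / 2" .
  have "{a<..M} = insert (Suc a) {Suc a<..M}" using step by auto
  then have "(\<Sum>k\<in>{a<..M}. bsgn (gbit M y k) / 2 ^ (k - a + 1)) =
      bsgn (bin_digit y h) / 4 + (\<Sum>k\<in>{Suc a<..M}. bsgn (gbit M y k) / 2 ^ (k - a + 1))"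
    by (simp add: gbit_def h_def)
  then show ?case unfolding h e by (simp add: diff_divide_distrib)
qed simp

lemma gbit_prefix:
  assumes "y < 2 ^ M" "u < 2 ^ M" "b \<le> M"
  shows "(\<forall>i\<in>{1..b}. gbit M y i = gbit M u i) \<longleftrightarrow> y div 2 ^ (M - b) = u div 2 ^ (M - b)"
  using assms(3)
proof (induction b)
  case 0
  then show ?case using assms by simp
next
  case (Suc b)
  define h where "h = M - Suc b"
  have h: "M - b = Suc h" using Suc.prems by (simp add: h_def)
  have *: "x div 2 ^ Suc h = x div 2 ^ h div 2" for x :: nat
    by (simp only: div_mult2_eq power_Suc2)
  have "{1..Suc b} = insert (Suc b) {1..b}" by auto
  then have "(\<forall>i\<in>{1..Suc b}. gbit M y i = gbit M u i) \<longleftrightarrow>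
      (even (y div 2 ^ h) \<longleftrightarrow> even (u div 2 ^ h)) \<and> y div 2 ^ h div 2 = u div 2 ^ h div 2"
    unfolding *[symmetric] h[symmetric] using Suc by (simp add: gbit_def bin_digit_eq_iff flip: h_def)
  also have "\<dots> \<longleftrightarrow> y div 2 ^ h = u div 2 ^ h"
    by (metis even_two_times_div_two odd_two_times_div_two_succ)
  finally show ?case by (simp add: h_def)
qed

text \<open>
  Up to the sign \<open>wsign\<close>, the Haar projection \<open>wav M a\<close> is a combination of the terms \<open>wterm M a k\<close>: the
  indicator that the first \<open>a - 1\<close> digits of \<open>y\<close> and \<open>u\<close> agree, times the Walsh function of the digits
  \<open>a\<close> and \<open>k\<close> of \<open>y\<close>. The index \<open>k = 0\<close> encodes the trivial Walsh function, \<open>k = a\<close> that of the single digit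
  \<open>a\<close>; for \<open>a = 0\<close> there is no digit \<open>a\<close>. The two largest positions in \<open>wrows a k\<close> sum to at most
  \<open>2 * a + (k - a)\<close> (with truncated subtraction), which is what the order 2 condition measures.
\<close>

definition wrows :: "nat \<Rightarrow> nat \<Rightarrow> nat set"
  where "wrows a k = {1..<a} \<union> (if k = 0 then {} else {a, k} - {0})"

definition wfac :: "nat \<Rightarrow> nat \<Rightarrow> nat \<Rightarrow> nat \<Rightarrow> bit \<Rightarrow> real"
  where "wfac M a u i b = (if i < a then of_bool (b = gbit M u i) else bsgn b)"

definition wterm :: "nat \<Rightarrow> nat \<Rightarrow> nat \<Rightarrow> nat \<Rightarrow> nat \<Rightarrow> real"
  where "wterm M a k u y = (\<Prod>i\<in>wrows a k. wfac M a u i (gbit M y i))"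

definition wcoef :: "nat \<Rightarrow> nat \<Rightarrow> nat \<Rightarrow> real"
  where "wcoef M a k =
    (if a = 0 then (if k = 0 then 1 / 2 + 1 / 2 ^ (M + 1) else 1 / 2 ^ (k + 1))
     else if k = 0 then 1 / 4 else if k = a then - (1 / 2 ^ (M - a + 2)) else - (1 / 2 ^ (k - a + 2)))"

definition wsign :: "nat \<Rightarrow> nat \<Rightarrow> nat \<Rightarrow> real"
  where "wsign M a u = (if a = 0 then 1 else - bsgn (gbit M u a))"

lemma abs_wsign [simp]: "\<bar>wsign M a u\<bar> = 1"
  by (simp add: wsign_def)

lemma abs_wcoef_le: "\<bar>wcoef M a k\<bar> \<le> (1 / 2) ^ (k - a)"
proof -
  have "(1 / 2 :: real) ^ n \<le> 1" for n by (intro power_le_one) auto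
  then have *: "1 / 2 ^ n \<le> (1 :: real)" for n by (simp add: power_one_over)
  show ?thesis
    using *[of M] *[of "M - a + 2"] *[of "k - a"] *[of k]
    by (auto simp: wcoef_def power_one_over divide_simps)
qed

lemma finite_wrows [simp]: "finite (wrows a k)"
  by (simp add: wrows_def)

text \<open>For \<open>a = 0\<close> the truncated \<open>a - 1\<close> is 0 and the prefix
  condition holds trivially, both numbers being below \<open>2 ^ M\<close>. For \<open>k = a\<close>
  the set \<open>{a, k}\<close> collapses, so the sign of digit \<open>a\<close> occurs only
  once.\<close>

lemma wterm_eq:
  assumes "y < 2 ^ M" "u < 2 ^ M" "a \<le> M" "k = 0 \<or> a \<le> k"
  shows "wterm M a k u y = of_bool (y div 2 ^ (M - (a - 1)) = u div 2 ^ (M - (a - 1))) *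
    (if k = 0 then 1 else (if a = 0 \<or> k = a then 1 else bsgn (gbit M y a)) * bsgn (gbit M y k))"
proof -
  have "wterm M a k u y = (\<Prod>i\<in>{1..<a}. wfac M a u i (gbit M y i)) *
      (\<Prod>i\<in>(if k = 0 then {} else {a, k} - {0}). wfac M a u i (gbit M y i))"
    unfolding wterm_def wrows_def using assms(4) by (intro prod.union_disjoint) auto
  also have "(\<Prod>i\<in>{1..<a}. wfac M a u i (gbit M y i)) = of_bool (\<forall>i\<in>{1..<a}. gbit M y i = gbit M u i)"
    by (auto simp: wfac_def)
  also have "{1..<a} = {1..a - 1}" by auto
  also have "(\<forall>i\<in>{1..a - 1}. gbit M y i = gbit M u i) \<longleftrightarrow> y div 2 ^ (M - (a - 1)) = u div 2 ^ (M - (a - 1))"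
    using assms by (intro gbit_prefix) auto
  also have "(\<Prod>i\<in>(if k = 0 then {} else {a, k} - {0}). wfac M a u i (gbit M y i)) =
    (if k = 0 then 1 else (if a = 0 \<or> k = a then 1 else bsgn (gbit M y a)) * bsgn (gbit M y k))"
    using assms(4) by (auto simp: wfac_def insert_Diff_if)
  finally show ?thesis .
qed

text \<open>\<open>mod_walsh_expansion\<close> is inserted into \<open>wav_pos\<close>. For positive
  \<open>a\<close>, the terms \<open>k > a\<close> give the products of the digits \<open>a\<close>
  and \<open>k\<close>, while the term \<open>k = a\<close> carries only the truncation constant
  \<open>1 / 2 ^ (M - a + 1)\<close> of the finite grid, halved.\<close>

lemma wav_expansion:
  assumes y: "y < 2 ^ M" and u: "u < 2 ^ M" and a: "a \<le> M"
  shows "wav M a y u = wsign M a u * (\<Sum>k\<in>insert 0 {a..M}. wcoef M a k * wterm M a k u y)"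
proof (cases "a = 0")
  case True
  have "insert 0 {a..M} = insert 0 {0<..M}" using True by auto
  then have "(\<Sum>k\<in>insert 0 {a..M}. wcoef M a k * wterm M a k u y) =
      1 / 2 + 1 / 2 ^ (M + 1) + (\<Sum>k\<in>{0<..M}. bsgn (gbit M y k) / 2 ^ (k + 1))"
    using True by (simp add: wterm_eq[OF y u] wcoef_def y u)
  also have "\<dots> = 1 - real (y mod 2 ^ M) / 2 ^ M"
    using mod_walsh_expansion[of 0 M y] by simp
  finally show ?thesis using True y u by (simp add: wav_def lev_def wsign_def)
next
  case False
  define h where "h = M - a"
  have h: "M - (a - 1) = Suc h" using False a by (simp add: h_def)
  let ?e = "of_bool (y div 2 ^ Suc h = u div 2 ^ Suc h) :: real"
  have "insert 0 {a..M} = insert 0 (insert a {a<..M})" using a by auto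
  then have "(\<Sum>k\<in>insert 0 {a..M}. wcoef M a k * wterm M a k u y) =
      wcoef M a 0 * wterm M a 0 u y + (wcoef M a a * wterm M a a u y + (\<Sum>k\<in>{a<..M}. wcoef M a k * wterm M a k u y))"
    using False by simp
  also have "(\<Sum>k\<in>{a<..M}. wcoef M a k * wterm M a k u y) =
      - (?e / 2 * bsgn (gbit M y a) * (\<Sum>k\<in>{a<..M}. bsgn (gbit M y k) / 2 ^ (k - a + 1)))"
    unfolding sum_distrib_left sum_negf[symmetric]
  proof (rule sum.cong[OF refl])
    fix k assume "k \<in> {a<..M}"
    then have k: "a \<le> k" "k \<noteq> a" "k \<noteq> 0" using False by auto
    show "wcoef M a k * wterm M a k u y = - (?e / 2 * bsgn (gbit M y a) * (bsgn (gbit M y k) / 2 ^ (k - a + 1)))"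
      using k False unfolding wterm_eq[OF y u a disjI2[OF k(1)]] h wcoef_def by simp
  qed
  also have "(\<Sum>k\<in>{a<..M}. bsgn (gbit M y k) / 2 ^ (k - a + 1)) = 1 / 2 - 1 / 2 ^ (h + 1) - real (y mod 2 ^ h) / 2 ^ h"
    using mod_walsh_expansion[OF a, of y] by (simp add: h_def)
  finally show ?thesis
    using False a unfolding wav_pos[OF _ a] wterm_eq[OF y u a disjI1[OF refl]] wterm_eq[OF y u a disjI2[OF order_refl]] h
    by (simp add: wav_pos wcoef_def wsign_def gbit_def flip: h_def) (simp add: field_simps)
qed

section \<open>Haar projections of the discrepancy of a net\<close>

lemma sum_grid_prod:
  fixes g :: "nat \<Rightarrow> bit \<Rightarrow> real"
  assumes "S \<subseteq> {1..M}"
  shows "(\<Sum>y<2 ^ M. \<Prod>i\<in>S. g i (gbit M y i)) = 2 ^ M * (\<Prod>i\<in>S. (g i 0 + g i 1) / 2)"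
proof -
  have reindex: "(\<Prod>l<M. F (M - l)) = (\<Prod>i\<in>{1..M}. F i)" for F :: "nat \<Rightarrow> real"
    by (rule prod.reindex_bij_witness[of _ "\<lambda>i. M - i" "\<lambda>l. M - l"]) auto
  have restrict: "(\<Prod>i\<in>{1..M}. if i \<in> S then F i else 1) = (\<Prod>i\<in>S. F i)" for F :: "nat \<Rightarrow> real"
    using assms by (simp add: prod.inter_restrict[symmetric] Int_absorb1)
  let ?f = "\<lambda>l b. if M - l \<in> S then g (M - l) b else 1"
  have "(\<Prod>l<M. ?f l (bin_digit y l)) = (\<Prod>i\<in>S. g i (gbit M y i))" for y
  proof -
    have "(\<Prod>l<M. ?f l (bin_digit y l)) = (\<Prod>l<M. (\<lambda>i. if i \<in> S then g i (gbit M y i) else 1) (M - l))"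
      by (intro prod.cong) (auto simp: gbit_def)
    then show ?thesis
      using reindex[of "\<lambda>i. if i \<in> S then g i (gbit M y i) else 1"] restrict[of "\<lambda>i. g i (gbit M y i)"] by simp
  qed
  moreover have "(\<Prod>l<M. ?f l 0 + ?f l 1) = 2 ^ M * (\<Prod>i\<in>S. (g i 0 + g i 1) / 2)"
  proof -
    have "(\<Prod>l<M. ?f l 0 + ?f l 1) = (\<Prod>l<M. 2 * (\<lambda>i. if i \<in> S then (g i 0 + g i 1) / 2 else 1) (M - l))"
      by (intro prod.cong) auto
    then show ?thesis
      using reindex[of "\<lambda>i. if i \<in> S then (g i 0 + g i 1) / 2 else 1"] restrict[of "\<lambda>i. (g i 0 + g i 1) / 2"]
      by (simp add: prod.distrib)
  qed
  ultimately show ?thesis using sum_prod_bin_digit[of ?f M] by simp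
qed

lemma sum_wterm_0:
  assumes "a \<le> M"
  shows "(\<Sum>y<2 ^ M. wterm M a 0 u y) = 2 ^ M * (1 / 2) ^ (a - 1)"
proof -
  have "wrows a 0 \<subseteq> {1..M}" using assms by (auto simp: wrows_def)
  from sum_grid_prod[OF this, of "wfac M a u"]
  have "(\<Sum>y<2 ^ M. wterm M a 0 u y) = 2 ^ M * (\<Prod>i\<in>wrows a 0. (wfac M a u i 0 + wfac M a u i 1) / 2)"
    by (simp add: wterm_def)
  also have "(\<Prod>i\<in>wrows a 0. (wfac M a u i 0 + wfac M a u i 1) / 2) = (\<Prod>i\<in>wrows a 0. 1 / 2)"
  proof (rule prod.cong[OF refl])
    fix i assume "i \<in> wrows a 0"
    then have "i < a" by (simp add: wrows_def)
    then show "(wfac M a u i 0 + wfac M a u i 1) / 2 = 1 / 2"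
      by (cases "gbit M u i") (simp_all add: wfac_def)
  qed
  finally show ?thesis by (simp add: wrows_def)
qed

lemma abs_wterm_le:
  assumes "y < 2 ^ M" "u < 2 ^ M" "a \<le> M" "k = 0 \<or> a \<le> k"
  shows "\<bar>wterm M a k u y\<bar> \<le> wterm M a 0 u y"
  unfolding wterm_eq[OF assms] wterm_eq[OF assms(1-3) disjI1[OF refl]] by (auto simp: abs_mult)

text \<open>The bound without cancellation, for the levels too fine for the order 2
  property.\<close>

lemma abs_wav_le:
  assumes y: "y < 2 ^ M" and u: "u < 2 ^ M" and a: "a \<le> M"
  shows "\<bar>wav M a y u\<bar> \<le> wterm M a 0 u y"
proof (cases "a = 0")
  case True
  have "real y / 2 ^ M \<le> 1" using y by simp
  then show ?thesis
    unfolding wterm_eq[OF y u a disjI1[OF refl]] using y u True by (simp add: wav_def lev_def)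
next
  case False
  define h where "h = M - a"
  have h: "M - (a - 1) = Suc h" using False a by (simp add: h_def)
  define w where "w = real (y mod 2 ^ h) / 2 ^ h"
  have "y mod 2 ^ h < 2 ^ h" by simp
  then have "real (y mod 2 ^ h) < 2 ^ h" by (metis of_nat_less_iff of_nat_numeral of_nat_power)
  then have w: "0 \<le> w" "w \<le> 1" by (simp_all add: w_def)
  have "\<bar>1 / 4 + bsgn (bin_digit y h) * (w - 1 / 2) / 2\<bar> \<le> 1"
    unfolding bsgn_bin_digit abs_le_iff using w by (auto simp: field_simps)
  then show ?thesis
    using False a unfolding wterm_eq[OF y u a disjI1[OF refl]] h
    by (auto simp: wav_pos abs_mult w_def h_def)
qed

lemma prefix_mono:
  fixes y u :: nat
  assumes "a' \<le> a" "y div 2 ^ (M - a) = u div 2 ^ (M - a)"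
  shows "y div 2 ^ (M - a') = u div 2 ^ (M - a')"
proof -
  have "M - a' = (M - a) + (M - a' - (M - a))" using assms by simp
  then show ?thesis using assms(2) by (metis div_mult2_eq power_add)
qed

lemma wterm_0_mono:
  assumes "y < 2 ^ M" "u < 2 ^ M" "a \<le> M" "a' \<le> a"
  shows "wterm M a 0 u y \<le> wterm M a' 0 u y"
proof -
  have "a' \<le> M" using assms by simp
  show ?thesis
    unfolding wterm_eq[OF assms(1-3) disjI1[OF refl]] wterm_eq[OF assms(1,2) \<open>a' \<le> M\<close> disjI1[OF refl]]
    using prefix_mono[of "a' - 1" "a - 1" y M u] assms by auto
qed

lemma wterm_0_sym:
  assumes "y < 2 ^ M" "u < 2 ^ M" "a \<le> M"
  shows "wterm M a 0 u y = wterm M a 0 y u"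
  unfolding wterm_eq[OF assms disjI1[OF refl]] wterm_eq[OF assms(2,1,3) disjI1[OF refl]] by auto

lemma wterm_0_nonneg: "wterm M a 0 u y \<ge> 0"
  unfolding wterm_def by (intro prod_nonneg) (auto simp: wfac_def wrows_def)

lemma wrows_props:
  assumes "k = 0 \<or> a \<le> k"
  shows "x \<in> wrows a k \<Longrightarrow> x \<le> 2 * a + (k - a)" "x \<in> wrows a k \<Longrightarrow> 1 \<le> x"
    "x \<in> wrows a k \<Longrightarrow> y \<in> wrows a k \<Longrightarrow> x \<noteq> y \<Longrightarrow> x + y \<le> 2 * a + (k - a)"
  using assms by (auto simp: wrows_def split: if_splits)

lemma wrows_le: "k \<le> M \<Longrightarrow> a \<le> M \<Longrightarrow> wrows a k \<subseteq> {1..M}"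
  by (auto simp: wrows_def split: if_splits)

text \<open>The index 0 has truncated exponent 0 and adds at most 1 to a geometric series bounded by
  4.\<close>

lemma sum_geometric_le: "(\<Sum>k\<in>insert 0 {a..M}. (3 / 4 :: real) ^ (k - a)) \<le> 5"
proof -
  have "(\<Sum>k\<in>{a..M}. (3 / 4 :: real) ^ (k - a)) = (\<Sum>i<Suc M - a. (3 / 4) ^ i)"
    by (rule sum.reindex_bij_witness[of _ "\<lambda>i. i + a" "\<lambda>k. k - a"]) auto
  also have "\<dots> \<le> 4"
    using geometric_sum[of "3 / 4 :: real" "Suc M - a"] by simp
  finally have "(\<Sum>k\<in>{a..M}. (3 / 4 :: real) ^ (k - a)) \<le> 4" .
  moreover have "(\<Sum>k\<in>insert 0 {a..M}. (3 / 4 :: real) ^ (k - a)) \<le> 1 + (\<Sum>k\<in>{a..M}. (3 / 4 :: real) ^ (k - a))"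
    by (cases "0 \<in> {a..M}") (auto simp: insert_absorb)
  ultimately show ?thesis by linarith
qed

text \<open>Serves to coarsen a dyadic box, one coordinate after the other, until the net is
  equidistributed on boxes of its size.\<close>

lemma exists_smaller_with_sum:
  fixes a :: "'i \<Rightarrow> nat"
  assumes "finite I" "h \<le> (\<Sum>j\<in>I. a j)"
  shows "\<exists>a'. (\<forall>j\<in>I. a' j \<le> a j) \<and> (\<Sum>j\<in>I. a' j) = h"
  using assms
proof (induction I arbitrary: h rule: finite_induct)
  case (insert x F)
  have "h - min h (a x) \<le> (\<Sum>j\<in>F. a j)" using insert by simp
  then obtain a' where a': "\<forall>j\<in>F. a' j \<le> a j" "(\<Sum>j\<in>F. a' j) = h - min h (a x)"
    using insert.IH by blast
  have "(\<Sum>j\<in>F. (a'(x := min h (a x))) j) = (\<Sum>j\<in>F. a' j)"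
    using insert.hyps by (intro sum.cong) auto
  then show ?case
    using insert.hyps a' by (intro exI[of _ "a'(x := min h (a x))"]) auto
qed simp

lemma half_power_sum_pred:
  fixes a :: "nat \<Rightarrow> nat"
  shows "(\<Prod>j\<in>{1..s}. (1 / 2 :: real) ^ (a j - 1)) \<le> 2 ^ s * (1 / 2) ^ (\<Sum>j = 1..s. a j)"
proof -
  have "(\<Prod>j\<in>{1..s}. (1 / 2 :: real) ^ (a j - 1)) \<le> (\<Prod>j\<in>{1..s}. 2 * (1 / 2) ^ a j)"
  proof (intro prod_mono conjI)
    show "(1 / 2 :: real) ^ (a j - 1) \<le> 2 * (1 / 2) ^ a j" for j by (cases "a j") auto
  qed simp
  then show ?thesis by (simp add: prod.distrib power_sum)
qed

text \<open>A digitally shifted order 2 net with points on the grid of mesh \<open>2 ^ - M\<close>: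
  \<open>Y i j\<close> is the numerator of a coordinate and \<open>d\<close> the digital shift.
  \<open>M\<close> and \<open>m\<close> are independent, since the grid will be adapted to
  \<open>N\<close> and not to the block.\<close>

locale digital_block =
  fixes s t m M :: nat and C :: "nat \<Rightarrow> nat \<Rightarrow> nat \<Rightarrow> bit" and d :: "nat \<Rightarrow> nat \<Rightarrow> bit"
    and Y :: "nat \<Rightarrow> nat \<Rightarrow> nat"
  assumes net: "order2_digital_net t m s C"
    and Y_less: "i < 2 ^ m \<Longrightarrow> j \<in> {1..s} \<Longrightarrow> Y i j < 2 ^ M"
    and Y_digit: "i < 2 ^ m \<Longrightarrow> j \<in> {1..s} \<Longrightarrow> k \<in> {1..M} \<Longrightarrow>
      gbit M (Y i j) k = d j k + (\<Sum>l = 1..m. bin_digit i (l - 1) * C j k l)"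
begin

definition \<Omega> :: "(nat \<Rightarrow> nat) set"
  where "\<Omega> = PiE {1..s} (\<lambda>_. {..<2 ^ M})"

text \<open>The level \<open>a\<close> component of the unnormalised discrepancy of the block. The
  volume enters as a mean over the whole grid, so that it is projected in the same way as the
  points.\<close>

definition haar :: "(nat \<Rightarrow> nat) \<Rightarrow> (nat \<Rightarrow> nat) \<Rightarrow> real"
  where "haar a u = (\<Sum>i<2 ^ m. \<Prod>j\<in>{1..s}. wav M (a j) (Y i j) (u j)) -
    2 ^ m * (\<Prod>j\<in>{1..s}. (\<Sum>y<2 ^ M. wav M (a j) y (u j)) / 2 ^ M)"

text \<open>\<open>pts\<close> and \<open>vol\<close> are the two parts of \<open>haar\<close> with
  Walsh terms in place of Haar projections. For \<open>k = 0\<close> the first counts the points in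
  the dyadic box of \<open>u\<close> that fixes \<open>a j - 1\<close> digits in coordinate
  \<open>j\<close>.\<close>

definition pts :: "(nat \<Rightarrow> nat) \<Rightarrow> (nat \<Rightarrow> nat) \<Rightarrow> (nat \<Rightarrow> nat) \<Rightarrow> real"
  where "pts a k u = (\<Sum>i<2 ^ m. \<Prod>j\<in>{1..s}. wterm M (a j) (k j) (u j) (Y i j))"

definition vol :: "(nat \<Rightarrow> nat) \<Rightarrow> (nat \<Rightarrow> nat) \<Rightarrow> (nat \<Rightarrow> nat) \<Rightarrow> real"
  where "vol a k u = 2 ^ m * (\<Prod>j\<in>{1..s}. (\<Sum>y<2 ^ M. wterm M (a j) (k j) (u j) y) / 2 ^ M)"

lemma \<Omega>_less: "u \<in> \<Omega> \<Longrightarrow> j \<in> {1..s} \<Longrightarrow> u j < 2 ^ M"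
  by (auto simp: \<Omega>_def)

text \<open>The product of the \<open>wterm\<close> depends on a point only through the digits in
  \<open>wrows\<close>. The weight condition makes the corresponding matrix rows independent, so by
  \<open>equidistribution\<close> the net yields the product of the means, which is also what the
  full grid yields.\<close>

lemma pts_eq_vol:
  assumes a: "\<And>j. j \<in> {1..s} \<Longrightarrow> a j \<le> M"
    and k: "\<And>j. j \<in> {1..s} \<Longrightarrow> k j \<in> insert 0 {a j..M}"
    and le: "(\<Sum>j = 1..s. 2 * a j + (k j - a j)) + t \<le> 2 * m"
  shows "pts a k u = vol a k u"
proof -
  let ?S = "\<lambda>j. wrows (a j) (k j)"
  let ?g = "\<lambda>p. wfac M (a (fst p)) (u (fst p)) (snd p)"
  have k': "k j = 0 \<or> a j \<le> k j" if "j \<in> {1..s}" for j using k[OF that] by auto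
  have kM: "?S j \<subseteq> {1..M}" if "j \<in> {1..s}" for j
    using k[OF that] a[OF that] by (intro wrows_le) auto
  have B: "2 * a j + (k j - a j) \<le> 2 * m" if "j \<in> {1..s}" for j
    using member_le_sum[of j "{1..s}" "\<lambda>j. 2 * a j + (k j - a j)"] that le by simp
  have ind: "lin_indep_family m (SIGMA j:{1..s}. ?S j) (\<lambda>(j, k). C j k)"
  proof (rule order2_lin_indep[OF net _ _ _ le])
    fix j assume j: "j \<in> {1..s}"
    show "?S j \<subseteq> {1..2 * m}" using wrows_props[OF k'[OF j]] B[OF j] by force
    fix x y assume x: "x \<in> ?S j" 
    show "x \<le> 2 * a j + (k j - a j)" using wrows_props(1)[OF k'[OF j] x] .
    assume "y \<in> ?S j" "x \<noteq> y"
    then show "x + y \<le> 2 * a j + (k j - a j)" by (rule wrows_props(3)[OF k'[OF j] x])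
  qed
  have "pts a k u = (\<Sum>i<2 ^ m. \<Prod>p\<in>(SIGMA j:{1..s}. ?S j).
      ?g p (d (fst p) (snd p) + (\<Sum>l = 1..m. bin_digit i (l - 1) * (\<lambda>(j, k). C j k) p l)))"
    unfolding pts_def
  proof (rule sum.cong[OF refl])
    fix i assume "i \<in> {..<2 ^ m :: nat}"
    then have i: "i < 2 ^ m" by simp
    have "(\<Prod>j\<in>{1..s}. wterm M (a j) (k j) (u j) (Y i j)) =
      (\<Prod>j\<in>{1..s}. \<Prod>r\<in>?S j. wfac M (a j) (u j) r (d j r + (\<Sum>l = 1..m. bin_digit i (l - 1) * C j r l)))"
      unfolding wterm_def
    proof (intro prod.cong[OF refl])
      fix j r assume j: "j \<in> {1..s}" and "r \<in> ?S j"
      then have "r \<in> {1..M}" using kM by blast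
      then show "wfac M (a j) (u j) r (gbit M (Y i j) r) =
          wfac M (a j) (u j) r (d j r + (\<Sum>l = 1..m. bin_digit i (l - 1) * C j r l))"
        by (simp only: Y_digit[OF i j])
    qed
    also have "\<dots> = (\<Prod>p\<in>(SIGMA j:{1..s}. ?S j).
      ?g p (d (fst p) (snd p) + (\<Sum>l = 1..m. bin_digit i (l - 1) * (\<lambda>(j, k). C j k) p l)))"
      by (subst prod.Sigma) (auto simp only: finite_wrows finite_atLeastAtMost case_prod_unfold)
    finally show "(\<Prod>j\<in>{1..s}. wterm M (a j) (k j) (u j) (Y i j)) = \<dots>" .
  qed
  also have "\<dots> = 2 ^ m * (\<Prod>p\<in>(SIGMA j:{1..s}. ?S j). (?g p 0 + ?g p 1) / 2)"
    by (rule equidistribution[OF ind]) auto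
  also have "(\<Prod>p\<in>(SIGMA j:{1..s}. ?S j). (?g p 0 + ?g p 1) / 2) =
      (\<Prod>j\<in>{1..s}. \<Prod>r\<in>?S j. (wfac M (a j) (u j) r 0 + wfac M (a j) (u j) r 1) / 2)"
    by (subst prod.Sigma) (auto simp: split_beta)
  also have "\<dots> = (\<Prod>j\<in>{1..s}. (\<Sum>y<2 ^ M. wterm M (a j) (k j) (u j) y) / 2 ^ M)"
    unfolding wterm_def by (intro prod.cong[OF refl]) (simp add: sum_grid_prod[OF kM])
  finally show ?thesis by (simp add: vol_def)
qed

lemma vol_0:
  assumes "\<And>j. j \<in> {1..s} \<Longrightarrow> a j \<le> M"
  shows "vol a (\<lambda>_. 0) u = 2 ^ m * (\<Prod>j\<in>{1..s}. (1 / 2) ^ (a j - 1))"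
  unfolding vol_def using assms by (simp add: sum_wterm_0)

lemma vol_0_le:
  assumes "\<And>j. j \<in> {1..s} \<Longrightarrow> a j \<le> M"
  shows "vol a (\<lambda>_. 0) u \<le> 2 ^ s * (2 ^ m * (1 / 2) ^ (\<Sum>j = 1..s. a j))"
proof -
  have "vol a (\<lambda>_. 0) u = 2 ^ m * (\<Prod>j\<in>{1..s}. (1 / 2) ^ (a j - 1))"
    by (rule vol_0) (rule assms)
  also have "\<dots> \<le> 2 ^ m * (2 ^ s * (1 / 2) ^ (\<Sum>j = 1..s. a j))"
    by (intro mult_left_mono half_power_sum_pred) simp
  finally show ?thesis by (simp only: mult.left_commute)
qed

lemma vol_0_nonneg: "vol a (\<lambda>_. 0) u \<ge> 0"
  unfolding vol_def by (intro mult_nonneg_nonneg prod_nonneg divide_nonneg_nonneg sum_nonneg ballI wterm_0_nonneg) auto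

lemma pts_0_nonneg: "pts a (\<lambda>_. 0) u \<ge> 0"
  unfolding pts_def by (intro sum_nonneg prod_nonneg wterm_0_nonneg)

lemma abs_pts_le:
  assumes u: "u \<in> \<Omega>" and a: "\<And>j. j \<in> {1..s} \<Longrightarrow> a j \<le> M"
    and k: "\<And>j. j \<in> {1..s} \<Longrightarrow> k j \<in> insert 0 {a j..M}"
  shows "\<bar>pts a k u\<bar> \<le> pts a (\<lambda>_. 0) u" and "\<bar>vol a k u\<bar> \<le> vol a (\<lambda>_. 0) u"
proof -
  have k': "k j = 0 \<or> a j \<le> k j" if "j \<in> {1..s}" for j using k[OF that] by auto
  have le: "\<bar>wterm M (a j) (k j) (u j) y\<bar> \<le> wterm M (a j) 0 (u j) y" if "j \<in> {1..s}" "y < 2 ^ M" for j y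
    using that by (intro abs_wterm_le \<Omega>_less[OF u] a k')
  show "\<bar>pts a k u\<bar> \<le> pts a (\<lambda>_. 0) u"
    unfolding pts_def
    by (rule order_trans[OF sum_abs]) (auto simp: abs_prod intro!: sum_mono prod_mono le Y_less)
  have "\<bar>(\<Sum>y<2 ^ M. wterm M (a j) (k j) (u j) y) / 2 ^ M\<bar> \<le> (\<Sum>y<2 ^ M. wterm M (a j) 0 (u j) y) / 2 ^ M"
    if "j \<in> {1..s}" for j
  proof -
    have "\<bar>\<Sum>y<2 ^ M. wterm M (a j) (k j) (u j) y\<bar> \<le> (\<Sum>y<2 ^ M. wterm M (a j) 0 (u j) y)"
      by (rule order_trans[OF sum_abs]) (auto intro!: sum_mono le that)
    then show ?thesis by (simp add: divide_right_mono)
  qed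
  then show "\<bar>vol a k u\<bar> \<le> vol a (\<lambda>_. 0) u"
    unfolding vol_def by (auto simp: abs_mult abs_prod intro!: mult_left_mono prod_mono)
qed

text \<open>Multiplying out the Walsh expansions treats the points and the volume alike, so each
  \<open>k\<close> contributes a difference of \<open>pts\<close> and \<open>vol\<close>, which
  vanishes in the range of \<open>pts_eq_vol\<close>.\<close>

lemma haar_expansion:
  assumes u: "u \<in> \<Omega>" and a: "\<And>j. j \<in> {1..s} \<Longrightarrow> a j \<le> M"
  shows "haar a u = (\<Prod>j\<in>{1..s}. wsign M (a j) (u j)) *
    (\<Sum>k\<in>PiE {1..s} (\<lambda>j. insert 0 {a j..M}). (\<Prod>j\<in>{1..s}. wcoef M (a j) (k j)) * (pts a k u - vol a k u))"
proof -
  let ?K = "PiE {1..s} (\<lambda>j. insert 0 {a j..M})"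
  let ?s = "\<Prod>j\<in>{1..s}. wsign M (a j) (u j)"
  let ?c = "\<lambda>k. \<Prod>j\<in>{1..s}. wcoef M (a j) (k j)"
  have wav: "wav M (a j) y (u j) = wsign M (a j) (u j) * (\<Sum>k\<in>insert 0 {a j..M}. wcoef M (a j) k * wterm M (a j) k (u j) y)"
    if "j \<in> {1..s}" "y < 2 ^ M" for j y
    using that by (intro wav_expansion \<Omega>_less[OF u] a)
  have "(\<Prod>j\<in>{1..s}. wav M (a j) (Y i j) (u j)) =
      ?s * (\<Sum>k\<in>?K. ?c k * (\<Prod>j\<in>{1..s}. wterm M (a j) (k j) (u j) (Y i j)))" if "i < 2 ^ m" for i
  proof -
    have "(\<Prod>j\<in>{1..s}. wav M (a j) (Y i j) (u j)) =
        (\<Prod>j\<in>{1..s}. wsign M (a j) (u j) * (\<Sum>k\<in>insert 0 {a j..M}. wcoef M (a j) k * wterm M (a j) k (u j) (Y i j)))"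
      by (intro prod.cong refl wav Y_less that)
    then show ?thesis by (subst (asm) prod.distrib, subst (asm) prod_sum_PiE) (auto simp: prod.distrib)
  qed
  then have 1: "(\<Sum>i<2 ^ m. \<Prod>j\<in>{1..s}. wav M (a j) (Y i j) (u j)) = ?s * (\<Sum>k\<in>?K. ?c k * pts a k u)"
    unfolding pts_def sum_distrib_left by (subst sum.swap) (auto simp: sum_distrib_left intro!: sum.cong)
  have "(\<Prod>j\<in>{1..s}. (\<Sum>y<2 ^ M. wav M (a j) y (u j)) / 2 ^ M) =
      (\<Prod>j\<in>{1..s}. wsign M (a j) (u j) * (\<Sum>k\<in>insert 0 {a j..M}. wcoef M (a j) k * ((\<Sum>y<2 ^ M. wterm M (a j) k (u j) y) / 2 ^ M)))"
  proof (rule prod.cong[OF refl])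
    fix j assume j: "j \<in> {1..s}"
    have "(\<Sum>y<2 ^ M. wav M (a j) y (u j)) =
      (\<Sum>y<2 ^ M. wsign M (a j) (u j) * (\<Sum>k\<in>insert 0 {a j..M}. wcoef M (a j) k * wterm M (a j) k (u j) y))"
      by (intro sum.cong refl wav j) simp
    also have "\<dots> = wsign M (a j) (u j) * (\<Sum>k\<in>insert 0 {a j..M}. wcoef M (a j) k * (\<Sum>y<2 ^ M. wterm M (a j) k (u j) y))"
      unfolding sum_distrib_left by (subst sum.swap) (simp only: )
    finally show "(\<Sum>y<2 ^ M. wav M (a j) y (u j)) / 2 ^ M =
      wsign M (a j) (u j) * (\<Sum>k\<in>insert 0 {a j..M}. wcoef M (a j) k * ((\<Sum>y<2 ^ M. wterm M (a j) k (u j) y) / 2 ^ M))"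
      by (simp only: times_divide_eq_right sum_divide_distrib[symmetric])
  qed
  also have "\<dots> = ?s * (\<Sum>k\<in>?K. ?c k * (\<Prod>j\<in>{1..s}. (\<Sum>y<2 ^ M. wterm M (a j) (k j) (u j) y) / 2 ^ M))"
    by (subst prod.distrib, subst prod_sum_PiE) (auto simp only: prod.distrib finite_insert finite_atLeastAtMost)
  finally have 2: "2 ^ m * (\<Prod>j\<in>{1..s}. (\<Sum>y<2 ^ M. wav M (a j) y (u j)) / 2 ^ M) = ?s * (\<Sum>k\<in>?K. ?c k * vol a k u)"
    unfolding vol_def by (simp only: sum_distrib_left mult.left_commute[of "2 ^ m"])
  show ?thesis unfolding haar_def 1 2
    by (simp only: right_diff_distrib sum_subtractf)
qed

text \<open>Terms whose total excess of \<open>k\<close> over \<open>a\<close> is at most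
  \<open>R\<close> vanish by \<open>pts_eq_vol\<close>. The others have coefficients at most
  \<open>(1 / 2) ^ ?e\<close> with \<open>?e > R\<close> and differences at most
  \<open>2 * V\<close>, where \<open>V\<close> is at most
  \<open>2 ^ s * 2 ^ (m - ?A)\<close>.\<close>

lemma abs_haar_le_near:
  assumes u: "u \<in> \<Omega>" and a: "\<And>j. j \<in> {1..s} \<Longrightarrow> a j \<le> M"
    and le: "2 * (\<Sum>j = 1..s. a j) + t \<le> 2 * m"
  shows "\<bar>haar a u\<bar> \<le> 2 * 10 ^ s * (3 / 2) ^ t * (8 / 9) ^ (m - (\<Sum>j = 1..s. a j))"
proof -
  let ?K = "PiE {1..s} (\<lambda>j. insert 0 {a j..M})"
  let ?A = "\<Sum>j = 1..s. a j"
  define R where "R = 2 * m - t - 2 * ?A"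
  define V where "V = vol a (\<lambda>_. 0) u"
  have V0: "V \<ge> 0" by (simp add: V_def vol_0_nonneg)
  have ptsV: "pts a (\<lambda>_. 0) u = V"
    unfolding V_def using le by (intro pts_eq_vol a) (auto simp: sum_distrib_left)
  have summand: "\<bar>(\<Prod>j\<in>{1..s}. wcoef M (a j) (k j)) * (pts a k u - vol a k u)\<bar> \<le>
      (2 / 3) ^ R * (2 * V) * (\<Prod>j\<in>{1..s}. (3 / 4) ^ (k j - a j))" if "k \<in> ?K" for k
  proof -
    have k: "k j \<in> insert 0 {a j..M}" if "j \<in> {1..s}" for j using \<open>k \<in> ?K\<close> that by (rule PiE_mem)
    let ?e = "\<Sum>j = 1..s. k j - a j"
    show ?thesis
    proof (cases "?e \<le> R")
      case True
      then have "(\<Sum>j = 1..s. 2 * a j + (k j - a j)) + t \<le> 2 * m"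
        using le by (simp add: sum.distrib R_def flip: sum_distrib_left)
      then show ?thesis using pts_eq_vol[of a k, OF a k] V0 by (simp add: prod_nonneg)
    next
      case False
      have "\<bar>\<Prod>j\<in>{1..s}. wcoef M (a j) (k j)\<bar> \<le> (\<Prod>j\<in>{1..s}. (1 / 2) ^ (k j - a j))"
        unfolding abs_prod by (intro prod_mono) (auto intro: abs_wcoef_le)
      \<comment> \<open>Of the decay \<open>1 / 2\<close>, the factor \<open>2 / 3\<close> is spent
        on smallness and \<open>3 / 4\<close> on summability over \<open>k\<close>. As
        \<open>R + t\<close> is twice \<open>m - ?A\<close>, the former beats the growth of
        \<open>V\<close>, because \<open>2 * (2 / 3) ^ 2 = 8 / 9 < 1\<close>.\<close>
      also have "\<dots> = (2 / 3 * (3 / 4)) ^ ?e" by (simp add: power_sum)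
      also have "\<dots> = (2 / 3) ^ ?e * (3 / 4) ^ ?e" by (simp only: power_mult_distrib)
      also have "\<dots> \<le> (2 / 3) ^ R * (3 / 4) ^ ?e"
        using False by (intro mult_right_mono power_decreasing) auto
      also have "(3 / 4 :: real) ^ ?e = (\<Prod>j\<in>{1..s}. (3 / 4) ^ (k j - a j))" by (simp add: power_sum)
      finally have c: "\<bar>\<Prod>j\<in>{1..s}. wcoef M (a j) (k j)\<bar> \<le> (2 / 3) ^ R * (\<Prod>j\<in>{1..s}. (3 / 4) ^ (k j - a j))" .
      have "\<bar>pts a k u - vol a k u\<bar> \<le> 2 * V"
        using abs_pts_le[of u a k, OF u a k] ptsV by (simp add: V_def)
      from mult_mono[OF c this] show ?thesis
        by (simp add: abs_mult prod_nonneg mult_ac)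
    qed
  qed
  have "\<bar>haar a u\<bar> = \<bar>\<Sum>k\<in>?K. (\<Prod>j\<in>{1..s}. wcoef M (a j) (k j)) * (pts a k u - vol a k u)\<bar>"
    by (subst haar_expansion[OF u]) (simp_all add: a abs_mult abs_prod)
  also have "\<dots> \<le> (\<Sum>k\<in>?K. (2 / 3) ^ R * (2 * V) * (\<Prod>j\<in>{1..s}. (3 / 4) ^ (k j - a j)))"
    by (rule order_trans[OF sum_abs sum_mono[OF summand]])
  also have "\<dots> = (2 / 3) ^ R * (2 * V) * (\<Prod>j\<in>{1..s}. \<Sum>k\<in>insert 0 {a j..M}. (3 / 4) ^ (k - a j))"
    by (subst prod_sum_PiE) (auto simp: sum_distrib_left)
  also have "\<dots> \<le> (2 / 3) ^ R * (2 * (2 ^ s * (2 ^ m * (1 / 2) ^ ?A))) * 5 ^ s"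
  proof (intro mult_mono)
    have "(\<Prod>j\<in>{1..s}. \<Sum>k\<in>insert 0 {a j..M}. (3 / 4 :: real) ^ (k - a j)) \<le> (\<Prod>j\<in>{1..s}. 5)"
      by (intro prod_mono conjI sum_geometric_le sum_nonneg) auto
    then show "(\<Prod>j\<in>{1..s}. \<Sum>k\<in>insert 0 {a j..M}. (3 / 4 :: real) ^ (k - a j)) \<le> 5 ^ s" by simp
    show "V \<le> 2 ^ s * (2 ^ m * (1 / 2) ^ ?A)" unfolding V_def by (rule vol_0_le[of a, OF a])
  qed (auto intro!: prod_nonneg sum_nonneg simp: V0)
  also have "\<dots> = 2 * 10 ^ s * (3 / 2) ^ t * (8 / 9) ^ (m - ?A)"
  proof -
    define D where "D = m - ?A"
    have m: "m = ?A + D" and R: "R + t = 2 * D" using le by (auto simp: D_def R_def)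
    have "(2 / 3 :: real) ^ R * (2 / 3) ^ t = (4 / 9) ^ D"
      by (simp add: power_add[symmetric] R power_mult power2_eq_square)
    moreover have "(2 / 3 :: real) ^ t * (3 / 2) ^ t = 1"
      by (simp flip: power_mult_distrib)
    ultimately have "(2 / 3 :: real) ^ R = (3 / 2) ^ t * (4 / 9) ^ D"
      by (metis mult.assoc mult.commute mult_1)
    moreover have "(2 :: real) ^ m * (1 / 2) ^ ?A = 2 ^ D"
      by (simp add: m power_add power_one_over)
    moreover have "(10 :: real) ^ s = 2 ^ s * 5 ^ s" "(8 / 9 :: real) ^ D = 2 ^ D * (4 / 9) ^ D"
      by (simp_all flip: power_mult_distrib)
    ultimately show ?thesis by (simp add: D_def)
  qed
  finally show ?thesis .
qed

end

section \<open>The norm of the discrepancy of a net\<close>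

lemma pnorm_le_mono:
  assumes "pnorm_le p \<Omega> f A" "A \<le> B"
  shows "pnorm_le p \<Omega> f B"
proof -
  have "A ^ p * real (card \<Omega>) \<le> B ^ p * real (card \<Omega>)"
    using assms by (intro mult_right_mono power_mono) (auto simp: pnorm_le_def)
  then show ?thesis using assms by (auto simp: pnorm_le_def)
qed

lemma power_add_le_two_power:
  fixes x y :: real
  assumes "x \<ge> 0" "y \<ge> 0"
  shows "(x + y) ^ n \<le> 2 ^ n * (x ^ n + y ^ n)"
proof -
  have "(x + y) ^ n \<le> (2 * max x y) ^ n" using assms by (intro power_mono) auto
  also have "\<dots> = 2 ^ n * max x y ^ n" by (rule power_mult_distrib)
  also have "max x y ^ n \<le> x ^ n + y ^ n" using assms by (auto simp: max_def)
  finally show ?thesis by simp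
qed

text \<open>Concerns the levels beyond the reach of the order 2 property. For \<open>A >= m\<close>
  the left side decays on its own; for \<open>A < m\<close> the distance \<open>e = m - A\<close>
  satisfies \<open>2 * e < t\<close>, and \<open>2 ^ e = 2 ^ (2 * e) * (1 / 2) ^ e\<close>.\<close>

lemma half_power_dist:
  fixes m A t :: nat
  assumes "2 * m < 2 * A + t"
  shows "2 ^ m * (1 / 2 :: real) ^ A \<le> 2 ^ t * (1 / 2) ^ ((A - m) + (m - A))"
proof (cases "m \<le> A")
  case True
  then obtain e where A: "A = m + e" using le_Suc_ex by blast
  have "2 ^ m * (1 / 2 :: real) ^ A = 1 * (1 / 2) ^ e" by (simp add: A power_add power_one_over)
  also have "\<dots> \<le> 2 ^ t * (1 / 2) ^ e" by (intro mult_right_mono) auto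
  finally show ?thesis by (simp add: A)
next
  case False
  then obtain e where m: "m = A + e" by (metis le_Suc_ex nat_le_linear)
  have "2 ^ m * (1 / 2 :: real) ^ A = 2 ^ (2 * e) * (1 / 2) ^ e"
    by (simp add: m power_add power_one_over mult_2)
  also have "\<dots> \<le> 2 ^ t * (1 / 2) ^ e"
    using assms by (intro mult_right_mono power_increasing) (auto simp: m)
  finally show ?thesis by (simp add: m)
qed

text \<open>The first summand covers the coarse levels of \<open>abs_haar_le_near\<close>, the
  second the remaining ones.\<close>

definition moment_const :: "nat \<Rightarrow> nat \<Rightarrow> nat \<Rightarrow> real"
  where "moment_const s t p =
    (2 * 10 ^ s * (3 / 2) ^ t) ^ (2 * p) + 2 ^ (2 * p + 1) * (2 ^ (s + t + 1)) ^ (2 * p) * 2 ^ (s + t)"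

lemma moment_const_ge_1: "moment_const s t p \<ge> 1"
proof -
  have "(1 :: real) \<le> 2 ^ (2 * p + 1) * (2 ^ (s + t + 1)) ^ (2 * p) * 2 ^ (s + t)"
    by (simp only: power_mult[symmetric] power_add[symmetric]) (rule one_le_power, simp)
  moreover have "(0 :: real) \<le> (2 * 10 ^ s * (3 / 2) ^ t) ^ (2 * p)" by simp
  ultimately show ?thesis unfolding moment_const_def by linarith
qed

context digital_block
begin

lemma card_\<Omega>: "real (card \<Omega>) = (2 ^ M) ^ s"
  by (simp add: \<Omega>_def card_PiE)

lemma t_le: "t \<le> 2 * m"
  using net by (simp add: order2_digital_net_def)

text \<open>Coarsening the levels to the total \<open>h\<close>, the largest at which
  \<open>pts_eq_vol\<close> still applies with \<open>k = 0\<close>, enlarges the box. The larger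
  box contains exactly its share of points, and \<open>m\<close> exceeds \<open>h\<close> by at most
  \<open>t + 1\<close>.\<close>

lemma pts_0_le_far:
  assumes u: "u \<in> \<Omega>" and a: "\<And>j. j \<in> {1..s} \<Longrightarrow> a j \<le> M"
    and far: "2 * m < 2 * (\<Sum>j = 1..s. a j) + t"
  shows "pts a (\<lambda>_. 0) u \<le> 2 ^ (s + t + 1)"
proof -
  define h where "h = (2 * m - t) div 2"
  have "h \<le> (\<Sum>j = 1..s. a j)" using far by (simp add: h_def)
  then obtain a' where a': "\<And>j. j \<in> {1..s} \<Longrightarrow> a' j \<le> a j" "(\<Sum>j = 1..s. a' j) = h"
    using exists_smaller_with_sum[of "{1..s}" h a] by blast
  have a'M: "a' j \<le> M" if "j \<in> {1..s}" for j using a[OF that] a'(1)[OF that] by simp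
  have "pts a (\<lambda>_. 0) u \<le> pts a' (\<lambda>_. 0) u"
    unfolding pts_def
    by (intro sum_mono prod_mono conjI wterm_0_nonneg wterm_0_mono)
      (use a a' Y_less \<Omega>_less[OF u] in auto)
  also have "\<dots> = vol a' (\<lambda>_. 0) u"
  proof (rule pts_eq_vol)
    have "2 * h + t \<le> 2 * m" using t_le by (simp add: h_def)
    then show "(\<Sum>j = 1..s. 2 * a' j + (0 - a' j)) + t \<le> 2 * m"
      using a'(2) by (simp flip: sum_distrib_left)
  qed (use a'M in auto)
  also have "\<dots> \<le> 2 ^ s * (2 ^ m * (1 / 2) ^ h)"
    unfolding a'(2)[symmetric] by (rule vol_0_le) (rule a'M)
  also have "(2 :: real) ^ m * (1 / 2) ^ h \<le> 2 ^ (h + t + 1) * (1 / 2) ^ h"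
    by (intro mult_right_mono power_increasing) (auto simp: h_def)
  also have "(2 :: real) ^ s * (2 ^ (h + t + 1) * (1 / 2) ^ h) = 2 ^ (s + t + 1)"
    by (simp add: power_add power_one_over)
  finally show ?thesis by simp
qed

text \<open>Sharing a box is a symmetric relation between the point and \<open>u\<close>, so summing
  over \<open>u\<close> first gives every point the same weight. The argument \<open>v\<close> is
  arbitrary because \<open>vol\<close> with \<open>k = 0\<close> is constant.\<close>

lemma sum_pts_0:
  assumes a: "\<And>j. j \<in> {1..s} \<Longrightarrow> a j \<le> M"
  shows "(\<Sum>u\<in>\<Omega>. pts a (\<lambda>_. 0) u) = vol a (\<lambda>_. 0) v * real (card \<Omega>)"
proof -
  have "(\<Sum>u\<in>\<Omega>. pts a (\<lambda>_. 0) u) = (\<Sum>i<2 ^ m. \<Sum>u\<in>\<Omega>. \<Prod>j\<in>{1..s}. wterm M (a j) 0 (u j) (Y i j))"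
    unfolding pts_def by (rule sum.swap)
  also have "\<dots> = (\<Sum>i<2 ^ m :: nat. \<Prod>j\<in>{1..s}. 2 ^ M * (1 / 2) ^ (a j - 1))"
  proof (rule sum.cong[OF refl])
    fix i assume "i \<in> {..<2 ^ m :: nat}"
    then have i: "i < 2 ^ m" by simp
    have "(\<Sum>u\<in>\<Omega>. \<Prod>j\<in>{1..s}. wterm M (a j) 0 (u j) (Y i j)) =
        (\<Prod>j\<in>{1..s}. \<Sum>u<2 ^ M. wterm M (a j) 0 u (Y i j))"
      unfolding \<Omega>_def by (rule prod_sum_PiE[symmetric]) auto
    also have "\<dots> = (\<Prod>j\<in>{1..s}. 2 ^ M * (1 / 2) ^ (a j - 1))"
    proof (rule prod.cong[OF refl])
      fix j assume j: "j \<in> {1..s}"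
      have "(\<Sum>u<2 ^ M. wterm M (a j) 0 u (Y i j)) = (\<Sum>u<2 ^ M. wterm M (a j) 0 (Y i j) u)"
        using Y_less[OF i j] a[OF j] by (intro sum.cong refl wterm_0_sym) auto
      then show "(\<Sum>u<2 ^ M. wterm M (a j) 0 u (Y i j)) = 2 ^ M * (1 / 2) ^ (a j - 1)"
        using sum_wterm_0[OF a[OF j]] by simp
    qed
    finally show "(\<Sum>u\<in>\<Omega>. \<Prod>j\<in>{1..s}. wterm M (a j) 0 (u j) (Y i j)) = (\<Prod>j\<in>{1..s}. 2 ^ M * (1 / 2) ^ (a j - 1))" .
  qed
  also have "\<dots> = 2 ^ m * (\<Prod>j\<in>{1..s}. (1 / 2) ^ (a j - 1)) * real (card \<Omega>)"
    by (simp add: prod.distrib card_\<Omega>)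
  also have "2 ^ m * (\<Prod>j\<in>{1..s}. (1 / 2) ^ (a j - 1)) = vol a (\<lambda>_. 0) v"
    by (rule vol_0[symmetric]) (rule a)
  finally show ?thesis .
qed

lemma abs_haar_le:
  assumes u: "u \<in> \<Omega>" and a: "\<And>j. j \<in> {1..s} \<Longrightarrow> a j \<le> M"
  shows "\<bar>haar a u\<bar> \<le> pts a (\<lambda>_. 0) u + vol a (\<lambda>_. 0) u"
proof -
  have le: "\<bar>wav M (a j) y (u j)\<bar> \<le> wterm M (a j) 0 (u j) y" if "j \<in> {1..s}" "y < 2 ^ M" for j y
    using that by (intro abs_wav_le \<Omega>_less[OF u] a)
  have 1: "\<bar>\<Sum>i<2 ^ m. \<Prod>j\<in>{1..s}. wav M (a j) (Y i j) (u j)\<bar> \<le> pts a (\<lambda>_. 0) u"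
    unfolding pts_def
    by (rule order_trans[OF sum_abs]) (auto simp: abs_prod intro!: sum_mono prod_mono le Y_less)
  have "\<bar>(\<Sum>y<2 ^ M. wav M (a j) y (u j)) / 2 ^ M\<bar> \<le> (\<Sum>y<2 ^ M. wterm M (a j) 0 (u j) y) / 2 ^ M"
    if "j \<in> {1..s}" for j
  proof -
    have "\<bar>\<Sum>y<2 ^ M. wav M (a j) y (u j)\<bar> \<le> (\<Sum>y<2 ^ M. wterm M (a j) 0 (u j) y)"
      by (rule order_trans[OF sum_abs]) (auto intro!: sum_mono le that)
    then show ?thesis by (simp add: divide_right_mono)
  qed
  then have 2: "\<bar>2 ^ m * (\<Prod>j\<in>{1..s}. (\<Sum>y<2 ^ M. wav M (a j) y (u j)) / 2 ^ M)\<bar> \<le> vol a (\<lambda>_. 0) u"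
    unfolding vol_def by (auto simp: abs_mult abs_prod intro!: mult_left_mono prod_mono)
  show ?thesis unfolding haar_def using 1 2 by linarith
qed

text \<open>On coarse levels the pointwise bound is raised to the power \<open>2 * p\<close>. On the
  others \<open>haar\<close> is at most the count plus the expected count, both bounded by
  \<open>L\<close>; hence the high moment is controlled by the first moment, which is the expected
  count \<open>V\<close> and decays by \<open>half_power_dist\<close>. The exponent of
  \<open>8 / 9\<close> is the distance between the total level and \<open>m\<close>, written with
  truncated subtraction.\<close>

lemma sum_haar_power_le:
  assumes a: "\<And>j. j \<in> {1..s} \<Longrightarrow> a j \<le> M" and p: "p \<ge> 1"
  shows "(\<Sum>u\<in>\<Omega>. haar a u ^ (2 * p)) \<le>
    moment_const s t p * (8 / 9) ^ (((\<Sum>j = 1..s. a j) - m) + (m - (\<Sum>j = 1..s. a j))) * real (card \<Omega>)"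
proof (cases "2 * (\<Sum>j = 1..s. a j) + t \<le> 2 * m")
  case True
  let ?D = "m - (\<Sum>j = 1..s. a j)"
  let ?c = "2 * 10 ^ s * (3 / 2) ^ t :: real"
  have "haar a u ^ (2 * p) \<le> moment_const s t p * (8 / 9) ^ ?D" if u: "u \<in> \<Omega>" for u
  proof -
    have "haar a u ^ (2 * p) = \<bar>haar a u\<bar> ^ (2 * p)" by (simp add: power_even_abs)
    also have "\<dots> \<le> (?c * (8 / 9) ^ ?D) ^ (2 * p)"
      by (intro power_mono abs_haar_le_near[OF u _ True] a) auto
    also have "\<dots> = ?c ^ (2 * p) * (8 / 9) ^ (?D * (2 * p))"
      by (simp only: power_mult_distrib power_mult)
    also have "\<dots> \<le> moment_const s t p * (8 / 9) ^ ?D"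
    proof (intro mult_mono)
      show "(8 / 9 :: real) ^ (?D * (2 * p)) \<le> (8 / 9) ^ ?D"
        using p by (intro power_decreasing) auto
      show "?c ^ (2 * p) \<le> moment_const s t p"
        unfolding moment_const_def by simp
    qed (use moment_const_ge_1[of s t p] in auto)
    finally show ?thesis .
  qed
  then have "(\<Sum>u\<in>\<Omega>. haar a u ^ (2 * p)) \<le> real (card \<Omega>) * (moment_const s t p * (8 / 9) ^ ?D)"
    by (rule sum_bounded_above)
  then show ?thesis using True by (simp add: mult_ac)
next
  case False
  let ?A = "\<Sum>j = 1..s. a j"
  let ?e = "(?A - m) + (m - ?A)"
  define L :: real where "L = 2 ^ (s + t + 1)"
  define V where "V = vol a (\<lambda>_. 0) (\<lambda>_. 0)"
  have V_eq: "vol a (\<lambda>_. 0) u = V" for u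
    unfolding V_def by (subst (1 2) vol_0) (use a in auto)
  have V0: "V \<ge> 0" unfolding V_def by (rule vol_0_nonneg)
  have L1: "L \<ge> 1" by (simp only: L_def one_le_power one_le_numeral)
  have "V \<le> 2 ^ s * (2 ^ m * (1 / 2) ^ ?A)" unfolding V_def by (rule vol_0_le) (rule a)
  also have "\<dots> \<le> 2 ^ s * (2 ^ t * (1 / 2) ^ ?e)"
    using False by (intro mult_left_mono half_power_dist) auto
  finally have V_half: "V \<le> 2 ^ (s + t) * (1 / 2) ^ ?e" by (simp add: power_add)
  also have "(2 :: real) ^ (s + t) * (1 / 2) ^ ?e \<le> 2 ^ (s + t) * 1"
    by (intro mult_left_mono power_le_one) auto
  also have "(2 :: real) ^ (s + t) * 1 \<le> L"
    by (simp add: L_def)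
  finally have VL: "V \<le> L" .
  have "V \<le> 2 ^ (s + t) * (8 / 9) ^ ?e"
    by (rule order_trans[OF V_half]) (intro mult_left_mono power_mono, auto)
  then have V: "V \<le> 2 ^ (s + t) * (8 / 9) ^ ?e" .
  have pw: "x ^ (2 * p) \<le> L ^ (2 * p) * x" if "0 \<le> x" "x \<le> L" for x
  proof -
    have "x ^ (2 * p) = x ^ (2 * p - 1) * x" using p by (simp flip: power_Suc2)
    also have "\<dots> \<le> L ^ (2 * p - 1) * x" using that by (intro mult_right_mono power_mono)
    also have "\<dots> \<le> L ^ (2 * p) * x" using that L1 by (intro mult_right_mono power_increasing) auto
    finally show ?thesis .
  qed
  have "haar a u ^ (2 * p) \<le> 2 ^ (2 * p) * (L ^ (2 * p) * pts a (\<lambda>_. 0) u + L ^ (2 * p) * V)" if u: "u \<in> \<Omega>" for u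
  proof -
    have "haar a u ^ (2 * p) = \<bar>haar a u\<bar> ^ (2 * p)" by (simp add: power_even_abs)
    also have "\<dots> \<le> (pts a (\<lambda>_. 0) u + V) ^ (2 * p)"
      using abs_haar_le[of u a, OF u] a by (intro power_mono) (auto simp: V_eq)
    also have "\<dots> \<le> 2 ^ (2 * p) * (pts a (\<lambda>_. 0) u ^ (2 * p) + V ^ (2 * p))"
      by (intro power_add_le_two_power pts_0_nonneg V0)
    also have "\<dots> \<le> 2 ^ (2 * p) * (L ^ (2 * p) * pts a (\<lambda>_. 0) u + L ^ (2 * p) * V)"
      using pts_0_le_far[of u a, OF u] a False
      by (intro mult_left_mono add_mono pw pts_0_nonneg V0 VL) (auto simp: L_def)
    finally show ?thesis .
  qed
  then have "(\<Sum>u\<in>\<Omega>. haar a u ^ (2 * p)) \<le> (\<Sum>u\<in>\<Omega>. 2 ^ (2 * p) * (L ^ (2 * p) * pts a (\<lambda>_. 0) u + L ^ (2 * p) * V))"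
    by (rule sum_mono)
  also have "\<dots> = 2 ^ (2 * p) * (L ^ (2 * p) * (\<Sum>u\<in>\<Omega>. pts a (\<lambda>_. 0) u) + L ^ (2 * p) * V * real (card \<Omega>))"
    by (simp add: sum.distrib distrib_left sum_distrib_left mult_ac)
  also have "(\<Sum>u\<in>\<Omega>. pts a (\<lambda>_. 0) u) = V * real (card \<Omega>)"
    unfolding V_def by (rule sum_pts_0) (rule a)
  also have "2 ^ (2 * p) * (L ^ (2 * p) * (V * real (card \<Omega>)) + L ^ (2 * p) * V * real (card \<Omega>)) =
      2 ^ (2 * p + 1) * L ^ (2 * p) * V * real (card \<Omega>)" by simp
  also have "\<dots> \<le> 2 ^ (2 * p + 1) * L ^ (2 * p) * (2 ^ (s + t) * (8 / 9) ^ ?e) * real (card \<Omega>)"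
    using L1 by (intro mult_right_mono mult_left_mono V) auto
  also have "\<dots> \<le> moment_const s t p * (8 / 9) ^ ?e * real (card \<Omega>)"
    unfolding moment_const_def L_def mult.assoc[symmetric] by (intro mult_right_mono) auto
  finally show ?thesis .
qed

text \<open>The root appears because \<open>pnorm_le\<close> raises its bound to the power
  \<open>p\<close>; the constant is at least 1 and can stay outside the root.\<close>

lemma pnorm_le_haar:
  assumes a: "\<And>j. j \<in> {1..s} \<Longrightarrow> a j \<le> M" and p: "p \<ge> 1"
  shows "pnorm_le p \<Omega> (haar a)
    (moment_const s t p * root p (8 / 9) ^ (((\<Sum>j = 1..s. a j) - m) + (m - (\<Sum>j = 1..s. a j))))"
proof -
  let ?e = "((\<Sum>j = 1..s. a j) - m) + (m - (\<Sum>j = 1..s. a j))"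
  let ?c = "moment_const s t p"
  have c: "?c \<ge> 1" by (rule moment_const_ge_1)
  have "(root p (8 / 9) ^ ?e) ^ p = (8 / 9) ^ ?e"
    using p by (simp add: power_mult[symmetric] mult.commute[of _ p] power_mult)
  moreover have "?c ^ 1 \<le> ?c ^ p" using c p by (intro power_increasing) auto
  ultimately have "?c * (8 / 9) ^ ?e \<le> (?c * root p (8 / 9) ^ ?e) ^ p"
    by (simp add: power_mult_distrib mult_right_mono)
  then have "?c * (8 / 9) ^ ?e * real (card \<Omega>) \<le> (?c * root p (8 / 9) ^ ?e) ^ p * real (card \<Omega>)"
    by (intro mult_right_mono) auto
  moreover have "(\<Sum>u\<in>\<Omega>. haar a u ^ (2 * p)) \<le> ?c * (8 / 9) ^ ?e * real (card \<Omega>)"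
    by (rule sum_haar_power_le) (use a p in auto)
  moreover have "?c * root p (8 / 9) ^ ?e > 0"
    using c p by (intro mult_pos_pos zero_less_power) auto
  ultimately show ?thesis unfolding pnorm_le_def by linarith
qed

text \<open>By \<open>sum_wav\<close> all projections together restore the indicators;
  \<open>u j + 1\<close> is the number of grid values up to \<open>u j\<close>.\<close>

lemma sum_haar:
  assumes u: "u \<in> \<Omega>"
  shows "(\<Sum>a\<in>PiE {1..s} (\<lambda>_. {..M}). haar a u) =
    (\<Sum>i<2 ^ m. \<Prod>j\<in>{1..s}. of_bool (Y i j \<le> u j)) - 2 ^ m * (\<Prod>j\<in>{1..s}. (real (u j) + 1) / 2 ^ M)"
proof -
  have "(\<Sum>a\<in>PiE {1..s} (\<lambda>_. {..M}). \<Sum>i<2 ^ m. \<Prod>j\<in>{1..s}. wav M (a j) (Y i j) (u j)) =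
      (\<Sum>i<2 ^ m. \<Prod>j\<in>{1..s}. of_bool (Y i j \<le> u j))"
    by (subst sum.swap, subst prod_sum_PiE[symmetric]) (simp_all add: sum_wav)
  moreover have "(\<Sum>a\<in>PiE {1..s} (\<lambda>_. {..M}). \<Prod>j\<in>{1..s}. (\<Sum>y<2 ^ M. wav M (a j) y (u j)) / 2 ^ M) =
      (\<Prod>j\<in>{1..s}. \<Sum>a\<le>M. (\<Sum>y<2 ^ M. wav M a y (u j)) / 2 ^ M)"
    by (rule prod_sum_PiE[symmetric]) auto
  moreover have "(\<Prod>j\<in>{1..s}. \<Sum>a\<le>M. (\<Sum>y<2 ^ M. wav M a y (u j)) / 2 ^ M) = (\<Prod>j\<in>{1..s}. (real (u j) + 1) / 2 ^ M)"
  proof (rule prod.cong[OF refl])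
    fix j assume j: "j \<in> {1..s}"
    have "(\<Sum>a\<le>M. (\<Sum>y<2 ^ M. wav M a y (u j)) / 2 ^ M) = (\<Sum>y<2 ^ M. of_bool (y \<le> u j)) / 2 ^ M"
      unfolding sum_divide_distrib[symmetric] by (subst sum.swap) (simp only: sum_wav)
    also have "(\<Sum>y<2 ^ M :: nat. of_bool (y \<le> u j) :: real) = (\<Sum>y\<le>u j. 1)"
      using \<Omega>_less[OF u j] by (intro sum.mono_neutral_cong_right) auto
    finally show "(\<Sum>a\<le>M. (\<Sum>y<2 ^ M. wav M a y (u j)) / 2 ^ M) = (real (u j) + 1) / 2 ^ M"
      by (simp add: add.commute)
  qed
  ultimately show ?thesis
    unfolding haar_def by (simp only: sum_subtractf sum_distrib_left[symmetric])
qed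

lemma block_pnorm_le_sum:
  assumes p: "p \<ge> 1"
  shows "pnorm_le p \<Omega>
    (\<lambda>u. (\<Sum>i<2 ^ m. \<Prod>j\<in>{1..s}. of_bool (Y i j \<le> u j)) - 2 ^ m * (\<Prod>j\<in>{1..s}. (real (u j) + 1) / 2 ^ M))
    ((4 * real p ^ 2) ^ s * (\<Sum>a\<in>PiE {1..s} (\<lambda>_. {..M}). moment_const s t p *
        root p (8 / 9) ^ (((\<Sum>j = 1..s. a j) - m) + (m - (\<Sum>j = 1..s. a j)))))"
proof -
  \<comment> \<open>\<open>T j c\<close> flips digit \<open>c\<close> of coordinate
    \<open>j\<close>: levels below \<open>c\<close> do not see this digit, and level
    \<open>c\<close> changes sign.\<close>
  define T where "T j c = (\<lambda>u. u(j := cell_flip (M - c) (u j)))" for j c :: nat and u :: "nat \<Rightarrow> nat"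
  let ?A = "\<lambda>a. moment_const s t p * root p (8 / 9) ^ (((\<Sum>j = 1..s. a j) - m) + (m - (\<Sum>j = 1..s. a j)))"
  have T\<Omega>: "T j c u \<in> \<Omega>" if "j \<in> {1..s}" "1 \<le> c" "c \<le> M" "u \<in> \<Omega>" for j c u
  proof -
    have "u \<in> PiE {1..s} (\<lambda>_. {..<2 ^ M})" using that by (simp add: \<Omega>_def)
    moreover have "cell_flip (M - c) (u j) < 2 ^ M"
      using that \<Omega>_less[of u j] by (intro cell_flip_less) auto
    ultimately have "u(j := cell_flip (M - c) (u j)) \<in> PiE (insert j {1..s}) (\<lambda>_. {..<2 ^ M})"
      by (intro PiE_fun_upd) auto
    then show ?thesis
      unfolding T_def \<Omega>_def using that(1) by (simp add: insert_absorb)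
  qed
  have inv: "wav M (a j') y (T j c u j') = wav M (a j') y (u j')" if "a j < c" "c \<le> M" for a :: "nat \<Rightarrow> nat" and j j' y c u
    using that by (simp add: T_def wav_flip_lower)
  have split: "(\<Prod>j'\<in>{1..s}. F j') = F j * (\<Prod>j'\<in>{1..s} - {j}. F j')" if "j \<in> {1..s}" for j and F :: "nat \<Rightarrow> real"
    using that by (simp add: prod.remove)
  have flip: "(\<Prod>j'\<in>{1..s}. wav M (a j') (y j') (T j (a j) u j')) = - (\<Prod>j'\<in>{1..s}. wav M (a j') (y j') (u j'))"
    if "j \<in> {1..s}" "1 \<le> a j" "a j \<le> M" for a y :: "nat \<Rightarrow> nat" and j u
    unfolding split[OF that(1)] using that(2,3) by (simp add: T_def wav_flip)
  have flip': "(\<Prod>j'\<in>{1..s}. (\<Sum>y<2 ^ M. wav M (a j') y (T j (a j) u j')) / 2 ^ M) =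
      - (\<Prod>j'\<in>{1..s}. (\<Sum>y<2 ^ M. wav M (a j') y (u j')) / 2 ^ M)"
    if "j \<in> {1..s}" "1 \<le> a j" "a j \<le> M" for a :: "nat \<Rightarrow> nat" and j u
    unfolding split[OF that(1)] using that(2,3) by (simp add: T_def wav_flip sum_negf)
  have "pnorm_le p \<Omega> (\<lambda>u. \<Sum>a\<in>PiE {1..s} (\<lambda>_. {..M}). haar a u)
    ((4 * real p ^ 2) ^ card {1..s} * (\<Sum>a\<in>PiE {1..s} (\<lambda>_. {..M}). ?A a))"
  proof (rule pnorm_le_multi_martingale[OF p, of _ _ T])
    show "bij_betw (T j c) \<Omega> \<Omega>" if "j \<in> {1..s}" "1 \<le> c" "c \<le> M" for j c
      using that T\<Omega> by (intro bij_betw_byWitness[of _ "T j c"]) (auto simp: T_def cell_flip_cell_flip)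
    show "haar a (T j c u) = haar a u" if "a j < c" "c \<le> M" for a j c u
      unfolding haar_def by (simp only: inv[of a j c, OF that])
    show "haar a (T j (a j) u) = - haar a u" if "j \<in> {1..s}" "1 \<le> a j" "a j \<le> M" for a j u
      unfolding haar_def flip[of j a, OF that] flip'[of j a, OF that] by (simp add: sum_negf)
    show "pnorm_le p \<Omega> (haar a) (?A a)" if "\<And>j. j \<in> {1..s} \<Longrightarrow> a j \<le> M" for a
      using that by (rule pnorm_le_haar) (use p in auto)
  qed auto
  then show ?thesis
    unfolding pnorm_le_def using sum_haar by (simp cong: sum.cong)
qed

end

section \<open>Summing the geometric decay over all levels\<close>

text \<open>The total determines the last coordinate from the other \<open>s - 1\<close>, each of
  which is at most \<open>k\<close>.\<close>

lemma card_sum_eq_le: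
  assumes "s \<ge> 1"
  shows "card {a \<in> PiE {1..s} (\<lambda>_. {..M}). (\<Sum>j = 1..s. a j) = k} \<le> (k + 1) ^ (s - 1)"
proof -
  let ?X = "{a \<in> PiE {1..s} (\<lambda>_. {..M}). (\<Sum>j = 1..s. a j) = k}"
  let ?P = "PiE {1..<s} (\<lambda>_. {..k})"
  have ins: "{1..s} = insert s {1..<s}" using assms by auto
  have sum: "(\<Sum>j = 1..s. a j) = a s + (\<Sum>j\<in>{1..<s}. a j)" for a :: "nat \<Rightarrow> nat"
    unfolding ins by simp
  have "card ?X \<le> card ?P"
  proof (rule card_inj_on_le)
    show "inj_on (\<lambda>a. restrict a {1..<s}) ?X"
    proof (rule inj_onI)
      fix a b assume a: "a \<in> ?X" and b: "b \<in> ?X" and eq: "restrict a {1..<s} = restrict b {1..<s}"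
      have *: "a j = b j" if "j \<in> {1..<s}" for j
        using fun_cong[OF eq, of j] that by simp
      then have "(\<Sum>j\<in>{1..<s}. a j) = (\<Sum>j\<in>{1..<s}. b j)" by (intro sum.cong) auto
      moreover have "a s + (\<Sum>j\<in>{1..<s}. a j) = k" "b s + (\<Sum>j\<in>{1..<s}. b j) = k"
        using a b sum[of a] sum[of b] by simp_all
      ultimately have "a s = b s" by linarith
      then show "a = b"
      proof (intro PiE_ext[of a "{1..s}" "\<lambda>_. {..M}" b])
        fix j assume "j \<in> {1..s}"
        then show "a j = b j" using * \<open>a s = b s\<close> by (cases "j = s") auto
      qed (use a b in auto)
    qed
    show "(\<lambda>a. restrict a {1..<s}) ` ?X \<subseteq> ?P"
    proof (rule image_subsetI)
      fix a assume "a \<in> ?X"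
      then have "a j \<le> k" if "j \<in> {1..<s}" for j
        using member_le_sum[of j "{1..s}" a] that by auto
      then show "restrict a {1..<s} \<in> ?P" by auto
    qed
    show "finite ?P" by (intro finite_PiE) auto
  qed
  also have "card ?P = (k + 1) ^ (s - 1)" by (simp add: card_PiE)
  finally show ?thesis .
qed

lemma summable_power_times_geometric:
  fixes x :: real
  assumes "0 < x" "x < 1"
  shows "summable (\<lambda>n. real (n + 1) ^ r * x ^ n)"
proof -
  have "(\<lambda>n. (1 + inverse (real (Suc n))) ^ r * x) \<longlonglongrightarrow> (1 + 0) ^ r * x"
    by (intro tendsto_intros LIMSEQ_inverse_real_of_nat)
  \<comment> \<open>\<open>(1 + x) / 2\<close> lies strictly between the limit \<open>x\<close> of
    the quotients and 1.\<close>
  then have "\<forall>\<^sub>F n in sequentially. (1 + inverse (real (Suc n))) ^ r * x < (1 + x) / 2"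
    using assms by (intro order_tendstoD(2)) auto
  then obtain N where N: "\<And>n. n \<ge> N \<Longrightarrow> (1 + inverse (real (Suc n))) ^ r * x < (1 + x) / 2"
    by (auto simp: eventually_sequentially)
  show ?thesis
  proof (rule summable_ratio_test)
    fix n assume n: "n \<ge> N"
    have "1 + inverse (real (Suc n)) = real (Suc n + 1) / real (n + 1)" by (simp add: field_simps)
    then have "real (Suc n + 1) ^ r * x ^ Suc n = (1 + inverse (real (Suc n))) ^ r * x * (real (n + 1) ^ r * x ^ n)"
      by (simp add: power_divide)
    also have "\<dots> \<le> (1 + x) / 2 * (real (n + 1) ^ r * x ^ n)"
      using N[OF n] assms by (intro mult_right_mono) auto
    finally show "norm (real (Suc n + 1) ^ r * x ^ Suc n) \<le> (1 + x) / 2 * norm (real (n + 1) ^ r * x ^ n)"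
      using assms by (simp add: abs_mult)
  qed (use assms in auto)
qed

text \<open>Indices are grouped by their total \<open>k\<close>. There are at most
  \<open>(k + 1) ^ (s - 1)\<close> of them, and with the distance \<open>e\<close> of
  \<open>k\<close> from \<open>m\<close>, \<open>k + 1 <= (m + 1) * (e + 1)\<close> separates the
  growth in \<open>m\<close> from a convergent series. The factor 2 accounts for the two sides of
  \<open>m\<close>.\<close>

lemma sum_dist_geometric_le:
  fixes x :: real
  assumes x: "0 < x" "x < 1" and s: "s \<ge> 1"
  shows "(\<Sum>a\<in>PiE {1..s} (\<lambda>_. {..M}). x ^ (((\<Sum>j = 1..s. a j) - m) + (m - (\<Sum>j = 1..s. a j)))) \<le>
    2 * (\<Sum>n. real (n + 1) ^ (s - 1) * x ^ n) * real (m + 1) ^ (s - 1)"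
proof -
  let ?P = "PiE {1..s} (\<lambda>_. {..M})"
  let ?S = "\<lambda>a. \<Sum>j = 1..s. a j"
  define e where "e k = (k - m) + (m - k)" for k
  define g where "g n = real (n + 1) ^ (s - 1) * x ^ n" for n
  have g0: "g n \<ge> 0" for n using x by (simp add: g_def)
  have summ: "summable g" unfolding g_def by (rule summable_power_times_geometric[OF x])
  have part: "(\<Sum>i\<le>n. g i) \<le> suminf g" for n
    by (rule sum_le_suminf[OF summ]) (auto simp: g0)
  have finP: "finite ?P" by (intro finite_PiE) auto
  have "(\<Sum>a\<in>?P. x ^ e (?S a)) = (\<Sum>k\<le>s * M. \<Sum>a\<in>{a \<in> ?P. ?S a = k}. x ^ e (?S a))"
  proof (rule sum.group[symmetric, OF finP])
    show "?S ` ?P \<subseteq> {..s * M}"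
    proof (rule image_subsetI)
      fix a assume a: "a \<in> ?P"
      have "?S a \<le> of_nat (card {1..s}) * M"
        using a by (intro sum_bounded_above) (auto simp: PiE_iff)
      then show "?S a \<in> {..s * M}" by simp
    qed
  qed simp
  also have "\<dots> = (\<Sum>k\<le>s * M. real (card {a \<in> ?P. ?S a = k}) * x ^ e k)"
    by (intro sum.cong) auto
  also have "\<dots> \<le> (\<Sum>k\<le>s * M. real (m + 1) ^ (s - 1) * g (e k))"
  proof (rule sum_mono)
    fix k
    have "real (card {a \<in> ?P. ?S a = k}) \<le> real ((k + 1) ^ (s - 1))"
      using card_sum_eq_le[OF s] by (simp only: of_nat_le_iff)
    also have "(k + 1) ^ (s - 1) \<le> ((m + 1) * (e k + 1)) ^ (s - 1)"
    proof (rule power_mono)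
      have "k + 1 \<le> m + 1 + e k" by (auto simp: e_def)
      also have "\<dots> \<le> (m + 1) * (e k + 1)" by simp
      finally show "k + 1 \<le> (m + 1) * (e k + 1)" .
    qed simp
    finally have "real (card {a \<in> ?P. ?S a = k}) \<le> real (((m + 1) * (e k + 1)) ^ (s - 1))" by simp
    then have "real (card {a \<in> ?P. ?S a = k}) \<le> real (m + 1) ^ (s - 1) * real (e k + 1) ^ (s - 1)"
      by (simp only: of_nat_power of_nat_mult power_mult_distrib)
    then show "real (card {a \<in> ?P. ?S a = k}) * x ^ e k \<le> real (m + 1) ^ (s - 1) * g (e k)"
      unfolding g_def mult.assoc[symmetric] using x by (intro mult_right_mono) auto
  qed
  also have "\<dots> = real (m + 1) ^ (s - 1) * (\<Sum>k\<le>s * M. g (e k))" by (simp add: sum_distrib_left)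
  also have "(\<Sum>k\<le>s * M. g (e k)) \<le> (\<Sum>k\<in>{..m} \<union> {m..m + s * M}. g (e k))"
    by (intro sum_mono2) (auto simp: g0)
  also have "\<dots> \<le> (\<Sum>k\<le>m. g (e k)) + (\<Sum>k\<in>{m..m + s * M}. g (e k))"
    by (subst sum_Un) (auto simp: g0 intro!: sum_nonneg)
  also have "(\<Sum>k\<le>m. g (e k)) = (\<Sum>i\<le>m. g i)"
    by (rule sum.reindex_bij_witness[of _ "\<lambda>i. m - i" "\<lambda>k. m - k"]) (auto simp: e_def)
  also have "(\<Sum>k\<in>{m..m + s * M}. g (e k)) = (\<Sum>i\<le>s * M. g i)"
    by (rule sum.reindex_bij_witness[of _ "\<lambda>i. m + i" "\<lambda>k. k - m"]) (auto simp: e_def)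
  also have "(\<Sum>i\<le>m. g i) + (\<Sum>i\<le>s * M. g i) \<le> 2 * suminf g"
    using part[of m] part[of "s * M"] by linarith
  finally show ?thesis
    unfolding e_def g_def by (simp add: mult_left_mono mult_ac)
qed

definition block_const :: "nat \<Rightarrow> nat \<Rightarrow> nat \<Rightarrow> real"
  where "block_const s t p = (4 * real p ^ 2) ^ s *
    (moment_const s t p * (2 * (\<Sum>n. real (n + 1) ^ (s - 1) * root p (8 / 9) ^ n)))"

text \<open>The bound is free of \<open>M\<close>, so the grid can be refined at no cost.\<close>

lemma (in digital_block) block_pnorm_le:
  assumes p: "p \<ge> 1" and s: "s \<ge> 1"
  shows "pnorm_le p \<Omega>
    (\<lambda>u. (\<Sum>i<2 ^ m. \<Prod>j\<in>{1..s}. of_bool (Y i j \<le> u j)) - 2 ^ m * (\<Prod>j\<in>{1..s}. (real (u j) + 1) / 2 ^ M))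
    (block_const s t p * real (m + 1) ^ (s - 1))"
proof (rule pnorm_le_mono[OF block_pnorm_le_sum[OF p]])
  have "0 < root p (8 / 9 :: real)" "root p (8 / 9 :: real) < 1"
    using p real_root_less_iff[of p "8 / 9" 1] by auto
  from sum_dist_geometric_le[OF this s, where M = M and m = m]
  have "(4 * real p ^ 2) ^ s * (moment_const s t p * (\<Sum>a\<in>PiE {1..s} (\<lambda>_. {..M}).
        root p (8 / 9) ^ (((\<Sum>j = 1..s. a j) - m) + (m - (\<Sum>j = 1..s. a j))))) \<le>
      (4 * real p ^ 2) ^ s * (moment_const s t p *
        (2 * (\<Sum>n. real (n + 1) ^ (s - 1) * root p (8 / 9) ^ n) * real (m + 1) ^ (s - 1)))"
    using moment_const_ge_1[of s t p] by (intro mult_left_mono) auto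
  then show "(4 * real p ^ 2) ^ s * (\<Sum>a\<in>PiE {1..s} (\<lambda>_. {..M}). moment_const s t p *
        root p (8 / 9) ^ (((\<Sum>j = 1..s. a j) - m) + (m - (\<Sum>j = 1..s. a j))))
      \<le> block_const s t p * real (m + 1) ^ (s - 1)"
    by (simp only: block_const_def sum_distrib_left mult.assoc)
qed

section \<open>Digital sequences\<close>

lemma bin_digit_add_low:
  assumes "i < 2 ^ m" "m \<le> l"
  shows "bin_digit (2 ^ m * c + i) l = bin_digit (2 ^ m * c) l"
proof -
  obtain e where l: "l = m + e" using assms le_Suc_ex by blast
  have "(2 ^ m * c + i) div 2 ^ l = (2 ^ m * c) div 2 ^ l"
    unfolding l power_add div_mult2_eq using assms(1) by simp
  then show ?thesis by (simp add: bin_digit_def)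
qed

lemma digital_digit_eq:
  assumes "n \<le> L"
  shows "digital_digit C n j k = (\<Sum>l = 1..L. bin_digit n (l - 1) * C j k l)"
  unfolding digital_digit_def bin_digit_def[symmetric]
proof (rule sum.mono_neutral_left)
  have "bin_digit n (l - 1) = 0" if "l \<in> {1..L} - {1..n}" for l
    using that bin_digit_less[of n n "l - 1"] by auto
  then show "\<forall>l\<in>{1..L} - {1..n}. bin_digit n (l - 1) * C j k l = 0"
    by (intro ballI) (simp only: mult_zero_left)
qed (use assms in auto)

text \<open>Adding \<open>i < 2 ^ m\<close> to a multiple of \<open>2 ^ m\<close> causes no carries.
  Such a block of points is therefore a copy of the first \<open>2 ^ m\<close> points, shifted
  digitally by the digits of the starting point.\<close>

lemma digital_digit_add:
  assumes i: "i < 2 ^ m"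
  shows "digital_digit C (2 ^ m * c + i) j k =
    digital_digit C (2 ^ m * c) j k + (\<Sum>l = 1..m. bin_digit i (l - 1) * C j k l)"
proof -
  \<comment> \<open>A common summation limit, at least the index of the point and at least
    \<open>m\<close>.\<close>
  define L where "L = 2 ^ m * c + i + m"
  have "bin_digit (2 ^ m * c + i) (l - 1) = bin_digit (2 ^ m * c) (l - 1) + (if l \<le> m then bin_digit i (l - 1) else 0)"
    if "l \<ge> 1" for l
  proof (cases "l \<le> m")
    case True
    then have "l - 1 < m" using that by simp
    from bin_digit_add_top[OF this, of c i] bin_digit_add_top[OF this, of c 0] show ?thesis
      using True by (simp add: bin_digit_def)
  next
    case False
    then show ?thesis using bin_digit_add_low[OF i, of "l - 1" c] by (simp only: if_False add_0_right)
  qed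
  then have "digital_digit C (2 ^ m * c + i) j k =
      (\<Sum>l = 1..L. bin_digit (2 ^ m * c) (l - 1) * C j k l + (if l \<le> m then bin_digit i (l - 1) else 0) * C j k l)"
    unfolding digital_digit_eq[of "2 ^ m * c + i" L C j k, OF le_add1[of "2 ^ m * c + i" m, folded L_def]]
    by (intro sum.cong[OF refl]) (simp only: atLeastAtMost_iff distrib_right)
  also have "\<dots> = (\<Sum>l = 1..L. bin_digit (2 ^ m * c) (l - 1) * C j k l) +
      (\<Sum>l = 1..L. (if l \<le> m then bin_digit i (l - 1) else 0) * C j k l)"
    by (rule sum.distrib)
  also have "(\<Sum>l = 1..L. bin_digit (2 ^ m * c) (l - 1) * C j k l) = digital_digit C (2 ^ m * c) j k"
    by (rule digital_digit_eq[symmetric]) (simp add: L_def)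
  also have "(\<Sum>l = 1..L. (if l \<le> m then bin_digit i (l - 1) else 0) * C j k l) =
      (\<Sum>l = 1..m. bin_digit i (l - 1) * C j k l)"
    by (rule sum.mono_neutral_cong_right) (auto simp: L_def)
  finally show ?thesis .
qed

definition from_bits :: "nat \<Rightarrow> (nat \<Rightarrow> bit) \<Rightarrow> nat"
  where "from_bits M f = (\<Sum>k = 1..M. of_bit (f k) * 2 ^ (M - k))"

lemma from_bits_Suc: "from_bits (Suc M) f = 2 * from_bits M f + of_bit (f (Suc M))"
proof -
  have "(\<Sum>k = 1..M. of_bit (f k) * 2 ^ (Suc M - k)) = 2 * from_bits M f"
    unfolding from_bits_def sum_distrib_left by (intro sum.cong) (auto simp: Suc_diff_le)
  then show ?thesis by (simp add: from_bits_def)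
qed

lemma from_bits_less: "from_bits M f < 2 ^ M"
proof (induction M)
  case (Suc M)
  then show ?case by (cases "f (Suc M)") (auto simp: from_bits_Suc)
qed (simp add: from_bits_def)

lemma gbit_from_bits: "k \<in> {1..M} \<Longrightarrow> gbit M (from_bits M f) k = f k"
proof (induction M)
  case (Suc M)
  show ?case
  proof (cases "k = Suc M")
    case True
    then show ?thesis
      by (cases "f (Suc M)") (simp_all add: gbit_def bin_digit_def from_bits_Suc)
  next
    case False
    then have k: "k \<in> {1..M}" "Suc M - k = Suc (M - k)" using Suc.prems by auto
    have "(2 * from_bits M f + of_bit (f (Suc M))) div 2 ^ Suc (M - k) = from_bits M f div 2 ^ (M - k)"
      unfolding power_Suc div_mult2_eq by (cases "f (Suc M)") simp_all
    then have "gbit (Suc M) (from_bits (Suc M) f) k = gbit M (from_bits M f) k"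
      unfolding gbit_def bin_digit_def from_bits_Suc k(2) by (simp only:)
    then show ?thesis using Suc.IH k by simp
  qed
qed simp

text \<open>Once the later digits vanish the series is finite, and the point lies on the grid
  without rounding.\<close>

lemma digital_sequence_eq:
  assumes "\<And>k. k > M \<Longrightarrow> digital_digit C n j k = 0"
  shows "digital_sequence C n j = real (from_bits M (digital_digit C n j)) / 2 ^ M"
proof -
  have "digital_sequence C n j = (\<Sum>k<M. of_bit (digital_digit C n j (Suc k)) / 2 ^ Suc k)"
    unfolding digital_sequence_def by (rule suminf_finite) (auto simp: assms)
  also have "\<dots> = (\<Sum>k = 1..M. of_bit (digital_digit C n j k) / 2 ^ k)"
    by (rule sum.reindex_bij_witness[of _ "\<lambda>k. k - 1" Suc]) auto
  also have "\<dots> = (\<Sum>k = 1..M. of_bit (digital_digit C n j k) * 2 ^ (M - k) / 2 ^ M)"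
    by (intro sum.cong refl) (auto simp: power_diff field_simps)
  also have "\<dots> = real (from_bits M (digital_digit C n j)) / 2 ^ M"
    unfolding from_bits_def
    by (simp only: of_nat_sum of_nat_mult of_nat_of_bool of_nat_power of_nat_numeral sum_divide_distrib)
  finally show ?thesis .
qed

section \<open>Splitting the first \<open>N\<close> points into blocks\<close>

text \<open>\<open>N\<close> times the local discrepancy at the upper corner
  \<open>(u + 1) / 2 ^ M\<close> of a grid cell: \<open>Y <= u\<close> is the same as
  \<open>Y / 2 ^ M < (u + 1) / 2 ^ M\<close>.\<close>

definition grid_error :: "nat \<Rightarrow> nat \<Rightarrow> nat \<Rightarrow> (nat \<Rightarrow> nat \<Rightarrow> nat) \<Rightarrow> (nat \<Rightarrow> nat) \<Rightarrow> real"
  where "grid_error s M N Y u =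
    (\<Sum>n<N. \<Prod>j\<in>{1..s}. of_bool (Y n j \<le> u j)) - real N * (\<Prod>j\<in>{1..s}. (real (u j) + 1) / 2 ^ M)"

text \<open>If \<open>t < 2 * m\<close>, the block is a shifted net and
  \<open>block_pnorm_le\<close> applies. Otherwise it has at most \<open>2 ^ t\<close> points, which
  bounds its error, and the summand \<open>4 ^ t\<close> bounds the square.\<close>

lemma block_bound:
  assumes seq: "order2_digital_sequence t s C" and p: "p \<ge> 1" and s: "s \<ge> 1"
  shows "pnorm_le p (PiE {1..s} (\<lambda>_. {..<2 ^ M}))
    (grid_error s M (2 ^ m) (\<lambda>i j. from_bits M (digital_digit C (2 ^ m * c + i) j)))
    ((\<bar>block_const s t p\<bar> + 4 ^ t) * real (m + 1) ^ (s - 1))"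
proof -
  let ?Y = "\<lambda>i j. from_bits M (digital_digit C (2 ^ m * c + i) j)"
  let ?\<Omega> = "PiE {1..s} (\<lambda>_. {..<2 ^ M :: nat})"
  have one: "1 \<le> real (m + 1) ^ (s - 1)" by (intro one_le_power) simp
  show ?thesis
  proof (cases "t < 2 * m")
    case True
    then have "real m > real t / 2" by simp
    then have net: "order2_digital_net t m s C"
      using seq unfolding order2_digital_sequence_def by blast
    interpret digital_block s t m M C "digital_digit C (2 ^ m * c)" ?Y
    proof
      show "gbit M (?Y i j) k = digital_digit C (2 ^ m * c) j k + (\<Sum>l = 1..m. bin_digit i (l - 1) * C j k l)"
        if "i < 2 ^ m" "k \<in> {1..M}" for i j k
        unfolding gbit_from_bits[OF that(2)] by (rule digital_digit_add[OF that(1)])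
    qed (use net from_bits_less in auto)
    have "grid_error s M (2 ^ m) ?Y = (\<lambda>u. (\<Sum>i<2 ^ m. \<Prod>j\<in>{1..s}. of_bool (?Y i j \<le> u j)) -
        2 ^ m * (\<Prod>j\<in>{1..s}. (real (u j) + 1) / 2 ^ M))"
      by (simp add: grid_error_def fun_eq_iff)
    then have "pnorm_le p ?\<Omega> (grid_error s M (2 ^ m) ?Y) (block_const s t p * real (m + 1) ^ (s - 1))"
      using block_pnorm_le[OF p s] by (simp only: \<Omega>_def)
    then show ?thesis
    proof (rule pnorm_le_mono)
      have "block_const s t p \<le> \<bar>block_const s t p\<bar> + 4 ^ t"
        by (rule order_trans[OF abs_ge_self]) simp
      then show "block_const s t p * real (m + 1) ^ (s - 1) \<le> (\<bar>block_const s t p\<bar> + 4 ^ t) * real (m + 1) ^ (s - 1)"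
        by (rule mult_right_mono) simp
    qed
  next
    case False
    have small: "\<bar>grid_error s M (2 ^ m) ?Y u\<bar> \<le> 2 ^ m" if u: "u \<in> ?\<Omega>" for u
    proof -
      have "real (u j) + 1 \<le> 2 ^ M" if "j \<in> {1..s}" for j
      proof -
        have "u j < 2 ^ M" using u that by auto
        then have "real (u j + 1) \<le> real (2 ^ M)" by (simp only: of_nat_le_iff)
        then show ?thesis by simp
      qed
      then have "0 \<le> (\<Prod>j\<in>{1..s}. (real (u j) + 1) / 2 ^ M)" "(\<Prod>j\<in>{1..s}. (real (u j) + 1) / 2 ^ M) \<le> 1"
        by (auto intro!: prod_nonneg prod_le_1)
      then have "0 \<le> real (2 ^ m) * (\<Prod>j\<in>{1..s}. (real (u j) + 1) / 2 ^ M)"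
        "real (2 ^ m) * (\<Prod>j\<in>{1..s}. (real (u j) + 1) / 2 ^ M) \<le> 2 ^ m"
        by auto
      moreover have "(\<Sum>n<2 ^ m. \<Prod>j\<in>{1..s}. of_bool (?Y n j \<le> u j)) \<le> (\<Sum>n<2 ^ m :: nat. 1 :: real)"
        by (intro sum_mono prod_le_1) auto
      then have "(\<Sum>n<2 ^ m. \<Prod>j\<in>{1..s}. of_bool (?Y n j \<le> u j)) \<le> (2 ^ m :: real)" by simp
      moreover have "0 \<le> (\<Sum>n<2 ^ m. \<Prod>j\<in>{1..s}. of_bool (?Y n j \<le> u j) :: real)"
        by (intro sum_nonneg prod_nonneg) auto
      ultimately show ?thesis
        unfolding grid_error_def by linarith
    qed
    have "grid_error s M (2 ^ m) ?Y u ^ (2 * p) \<le> (4 ^ t) ^ p" if "u \<in> ?\<Omega>" for u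
    proof -
      have "grid_error s M (2 ^ m) ?Y u ^ (2 * p) = \<bar>grid_error s M (2 ^ m) ?Y u\<bar> ^ (2 * p)"
        by (simp add: power_even_abs)
      also have "\<dots> \<le> (2 ^ t) ^ (2 * p)"
      proof (intro power_mono)
        have "(2 :: real) ^ m \<le> 2 ^ t" using False by (intro power_increasing) auto
        then show "\<bar>grid_error s M (2 ^ m) ?Y u\<bar> \<le> 2 ^ t"
          using small[OF that] by linarith
      qed simp
      also have "\<dots> = (4 ^ t) ^ p"
        by (simp add: power_mult power2_eq_square flip: power_mult_distrib)
      finally show ?thesis .
    qed
    then have "(\<Sum>u\<in>?\<Omega>. grid_error s M (2 ^ m) ?Y u ^ (2 * p)) \<le> real (card ?\<Omega>) * (4 ^ t) ^ p"
      by (rule sum_bounded_above)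
    then have "pnorm_le p ?\<Omega> (grid_error s M (2 ^ m) ?Y) (4 ^ t)"
      by (simp add: pnorm_le_def mult.commute)
    then show ?thesis
    proof (rule pnorm_le_mono)
      have "4 ^ t * 1 \<le> (\<bar>block_const s t p\<bar> + 4 ^ t) * real (m + 1) ^ (s - 1)"
        by (intro mult_mono one) auto
      then show "4 ^ t \<le> (\<bar>block_const s t p\<bar> + 4 ^ t) * real (m + 1) ^ (s - 1)" by simp
    qed
  qed
qed

lemma sum_blocks:
  fixes F :: "nat \<Rightarrow> real" and m :: "nat \<Rightarrow> nat"
  shows "(\<Sum>n<(\<Sum>v = 1..r. 2 ^ m v). F n) = (\<Sum>v = 1..r. \<Sum>i<2 ^ m v. F ((\<Sum>w = 1..<v. 2 ^ m w) + i))"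
proof (induction r)
  case (Suc r)
  have "(\<Sum>n<(\<Sum>v = 1..Suc r. 2 ^ m v). F n) = (\<Sum>n<(\<Sum>v = 1..r. 2 ^ m v) + 2 ^ m (Suc r). F n)"
    by simp
  also have "\<dots> = (\<Sum>n<(\<Sum>v = 1..r. 2 ^ m v). F n) + (\<Sum>i<2 ^ m (Suc r). F ((\<Sum>v = 1..r. 2 ^ m v) + i))"
    by (rule sum_lessThan_add)
  also have "{1..r} = {1..<Suc r}" by auto
  finally show ?case using Suc.IH by (simp add: atLeastLessThanSuc_atLeastAtMost)
qed simp

text \<open>All earlier exponents are larger; this makes the start of a block a multiple of its
  length, as \<open>digital_digit_add\<close> demands.\<close>

lemma block_start_dvd:
  fixes m :: "nat \<Rightarrow> nat"
  assumes "strict_antimono_on {1..r} m" "v \<in> {1..r}"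
  shows "2 ^ m v dvd (\<Sum>w = 1..<v. 2 ^ m w :: nat)"
proof (rule dvd_sum)
  fix w assume "w \<in> {1..<v}"
  then have "m v < m w" using assms unfolding monotone_on_def by auto
  then show "2 ^ m v dvd (2 ^ m w :: nat)" by (simp add: le_imp_power_dvd)
qed

lemma grid_error_blocks:
  fixes m :: "nat \<Rightarrow> nat"
  assumes "N = (\<Sum>v = 1..r. 2 ^ m v)"
  shows "grid_error s M N Y u = (\<Sum>v = 1..r. grid_error s M (2 ^ m v) (\<lambda>i. Y ((\<Sum>w = 1..<v. 2 ^ m w) + i)) u)"
proof -
  have "real N = (\<Sum>v = 1..r. 2 ^ m v)" by (simp add: assms)
  then show ?thesis
    unfolding grid_error_def sum_subtractf assms sum_blocks by (simp add: sum_distrib_right)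
qed

text \<open>Minkowski adds up the norms of the blocks; the square roots are there since
  \<open>pnorm_le\<close> bounds squared norms. The summand \<open>real s\<close> is room for the
  error of rounding to the grid.\<close>

lemma grid_moment_bound:
  fixes m :: "nat \<Rightarrow> nat"
  assumes seq: "order2_digital_sequence t s C" and p: "p \<ge> 1" and s: "s \<ge> 1" and r: "r \<ge> 1"
    and N: "N = (\<Sum>v = 1..r. 2 ^ m v)" and m: "strict_antimono_on {1..r} m"
  defines "K \<equiv> \<bar>block_const s t p\<bar> + 4 ^ t"
  shows "(\<Sum>u\<in>PiE {1..s} (\<lambda>_. {..<2 ^ M}).
      (real s + \<bar>grid_error s M N (\<lambda>n j. from_bits M (digital_digit C n j)) u\<bar>) ^ (2 * p)) \<le>
    (real s + (\<Sum>v = 1..r. sqrt (K * real (m v + 1) ^ (s - 1)))) ^ (2 * p) *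
      real (card (PiE {1..s} (\<lambda>_. {..<2 ^ M :: nat})))"
proof -
  let ?\<Omega> = "PiE {1..s} (\<lambda>_. {..<2 ^ M :: nat})"
  let ?Y = "\<lambda>n j. from_bits M (digital_digit C n j)"
  let ?E = "\<lambda>v. grid_error s M (2 ^ m v) (\<lambda>i. ?Y ((\<Sum>w = 1..<v. 2 ^ m w) + i))"
  let ?A = "\<lambda>v. K * real (m v + 1) ^ (s - 1)"
  have K: "K > 0" by (simp add: K_def add_nonneg_pos)
  have A: "?A v > 0" for v using K by simp
  have block: "(\<Sum>u\<in>?\<Omega>. \<bar>?E v u\<bar> ^ (2 * p)) \<le> sqrt (?A v) ^ (2 * p) * real (card ?\<Omega>)" if v: "v \<in> {1..r}" for v
  proof -
    obtain c where "(\<Sum>w = 1..<v. 2 ^ m w :: nat) = 2 ^ m v * c"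
      using block_start_dvd[OF m v] by (auto elim: dvdE)
    then have "pnorm_le p ?\<Omega> (?E v) (?A v)"
      using block_bound[OF seq p s, of M "m v" c] by (simp add: K_def)
    then show ?thesis
      using A[of v] by (simp add: pnorm_le_def power_even_abs power_mult)
  qed
  have "(\<Sum>u\<in>?\<Omega>. (\<Sum>v = 1..r. \<bar>?E v u\<bar>) ^ (2 * p)) \<le> (\<Sum>v = 1..r. sqrt (?A v)) ^ (2 * p) * real (card ?\<Omega>)"
    by (rule minkowski_pow_sum) (use r A block in auto)
  then have le: "(\<Sum>u\<in>?\<Omega>. (real s + (\<Sum>v = 1..r. \<bar>?E v u\<bar>)) ^ (2 * p)) \<le>
      (real s + (\<Sum>v = 1..r. sqrt (?A v))) ^ (2 * p) * real (card ?\<Omega>)"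
    using s r A by (intro minkowski_pow) (auto intro!: sum_nonneg sum_pos)
  have "(real s + \<bar>grid_error s M N ?Y u\<bar>) ^ (2 * p) \<le> (real s + (\<Sum>v = 1..r. \<bar>?E v u\<bar>)) ^ (2 * p)" for u
    unfolding grid_error_blocks[OF N] by (intro power_mono add_left_mono sum_abs) auto
  then show ?thesis by (rule order_trans[OF sum_mono le])
qed

section \<open>From grid moments to the norm of the local discrepancy\<close>

text \<open>Within one cell the count does not change, since the points have coordinates in
  multiples of \<open>1 / 2 ^ M\<close> and the cell is open on the left and closed on the right.
  The volume changes by at most \<open>s / 2 ^ M\<close>, and \<open>N <= 2 ^ M\<close> turns this
  into at most \<open>s\<close> after multiplication by \<open>N\<close>.\<close>

lemma local_discrepancy_le_grid_error:
  fixes x :: "nat \<Rightarrow> nat \<Rightarrow> real"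
  assumes N: "N \<ge> 1" "real N \<le> 2 ^ M"
    and x: "\<And>n j. n < N \<Longrightarrow> j \<in> {1..s} \<Longrightarrow> x n j = real (Y n j) / 2 ^ M"
    and u: "\<And>j. j \<in> {1..s} \<Longrightarrow> u j < 2 ^ M"
    and \<theta>: "\<And>j. j \<in> {1..s} \<Longrightarrow> \<theta> j \<in> {real (u j) / 2 ^ M<..(real (u j) + 1) / 2 ^ M}"
  shows "\<bar>local_discrepancy s N x \<theta>\<bar> \<le> (real s + \<bar>grid_error s M N Y u\<bar>) / real N"
proof -
  let ?w = "\<lambda>j. (real (u j) + 1) / 2 ^ M"
  have mem: "x n j \<in> {0..<\<theta> j} \<longleftrightarrow> Y n j \<le> u j" if "n < N" "j \<in> {1..s}" for n j
  proof
    assume "x n j \<in> {0..<\<theta> j}"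
    then have "real (Y n j) / 2 ^ M < (real (u j) + 1) / 2 ^ M"
      using \<theta>[OF that(2)] x[OF that] by auto
    then have "real (Y n j) < real (u j + 1)" by (simp add: divide_less_cancel)
    then show "Y n j \<le> u j" by (simp only: of_nat_less_iff)
  next
    assume "Y n j \<le> u j"
    then have "real (Y n j) / 2 ^ M \<le> real (u j) / 2 ^ M" by (intro divide_right_mono) auto
    then show "x n j \<in> {0..<\<theta> j}" using \<theta>[OF that(2)] x[OF that] by auto
  qed
  have "{n. n < N \<and> (\<forall>j\<in>{1..s}. x n j \<in> {0..<\<theta> j})} = {n \<in> {..<N}. \<forall>j\<in>{1..s}. Y n j \<le> u j}"
    using mem by blast
  then have "real (card {n. n < N \<and> (\<forall>j\<in>{1..s}. x n j \<in> {0..<\<theta> j})}) =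
      (\<Sum>n<N. of_bool (\<forall>j\<in>{1..s}. Y n j \<le> u j))"
    by (simp add: Int_def)
  also have "\<dots> = (\<Sum>n<N. \<Prod>j\<in>{1..s}. of_bool (Y n j \<le> u j))"
    by (intro sum.cong refl) (auto intro: prod_zero)
  finally have card: "real (card {n. n < N \<and> (\<forall>j\<in>{1..s}. x n j \<in> {0..<\<theta> j})}) =
      (\<Sum>n<N. \<Prod>j\<in>{1..s}. of_bool (Y n j \<le> u j))" .
  have w: "?w j \<le> 1" if "j \<in> {1..s}" for j
  proof -
    have "real (u j + 1) \<le> real (2 ^ M)" using u[OF that] by (simp only: of_nat_le_iff)
    then show ?thesis by simp
  qed
  have "\<bar>(\<Prod>j\<in>{1..s}. ?w j) - (\<Prod>j\<in>{1..s}. \<theta> j)\<bar> \<le> (\<Sum>j = 1..s. \<bar>?w j - \<theta> j\<bar>)"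
    unfolding real_norm_def[symmetric]
  proof (rule norm_prod_diff)
    fix j assume j: "j \<in> {1..s}"
    show "norm (?w j) \<le> 1" using w[OF j] by simp
    have "0 \<le> real (u j) / 2 ^ M" "real (u j) / 2 ^ M < \<theta> j" "\<theta> j \<le> ?w j" using \<theta>[OF j] by auto
    then show "norm (\<theta> j) \<le> 1" unfolding real_norm_def using w[OF j] by linarith
  qed
  also have "\<dots> \<le> (\<Sum>j = 1..s. 1 / 2 ^ M)"
  proof (rule sum_mono)
    fix j assume "j \<in> {1..s}"
    then show "\<bar>?w j - \<theta> j\<bar> \<le> 1 / 2 ^ M" using \<theta>[of j] by (auto simp: add_divide_distrib)
  qed
  finally have "real N * \<bar>(\<Prod>j\<in>{1..s}. ?w j) - (\<Prod>j\<in>{1..s}. \<theta> j)\<bar> \<le> 2 ^ M * (\<Sum>j = 1..s. 1 / 2 ^ M)"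
    using N(2) by (intro mult_mono) auto
  then have err: "real N * \<bar>(\<Prod>j\<in>{1..s}. ?w j) - (\<Prod>j\<in>{1..s}. \<theta> j)\<bar> \<le> real s" by simp
  have "real N * local_discrepancy s N x \<theta> =
      grid_error s M N Y u + real N * ((\<Prod>j\<in>{1..s}. ?w j) - (\<Prod>j\<in>{1..s}. \<theta> j))"
    unfolding local_discrepancy_def card grid_error_def using N(1) by (simp add: algebra_simps)
  then have "real N * \<bar>local_discrepancy s N x \<theta>\<bar> =
      \<bar>grid_error s M N Y u + real N * ((\<Prod>j\<in>{1..s}. ?w j) - (\<Prod>j\<in>{1..s}. \<theta> j))\<bar>"
    by (metis abs_mult abs_of_nat)
  also have "\<dots> \<le> \<bar>grid_error s M N Y u\<bar> + real N * \<bar>(\<Prod>j\<in>{1..s}. ?w j) - (\<Prod>j\<in>{1..s}. \<theta> j)\<bar>"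
    by (rule order_trans[OF abs_triangle_ineq]) (simp add: abs_mult)
  finally show ?thesis using err N(1) by (simp add: field_simps)
qed

text \<open>The integrand is dominated by a step function that is constant on the cells. All cells
  have the measure \<open>(1 / 2 ^ M) ^ s\<close>, so its integral is the average over the grid that
  \<open>mom\<close> bounds, scaled by a power of \<open>N\<close>.\<close>

lemma Lq_discrepancy_le_grid:
  fixes x :: "nat \<Rightarrow> nat \<Rightarrow> real"
  assumes p: "p \<ge> 1" and s: "s \<ge> 1" and B: "B \<ge> 0" and N: "N \<ge> 1" "real N \<le> 2 ^ M"
    and x: "\<And>n j. n < N \<Longrightarrow> j \<in> {1..s} \<Longrightarrow> x n j = real (Y n j) / 2 ^ M"
    and mom: "(\<Sum>u\<in>PiE {1..s} (\<lambda>_. {..<2 ^ M}). (real s + \<bar>grid_error s M N Y u\<bar>) ^ (2 * p)) \<le>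
      B ^ (2 * p) * real (card (PiE {1..s} (\<lambda>_. {..<2 ^ M :: nat})))"
  shows "Lq_discrepancy s (real (2 * p)) N x \<le> B / real N"
proof -
  let ?\<Omega> = "PiE {1..s} (\<lambda>_. {..<2 ^ M :: nat})"
  let ?M = "PiM {1..s} (\<lambda>_. lborel :: real measure)"
  let ?c = "\<lambda>u. ((real s + \<bar>grid_error s M N Y u\<bar>) / real N) ^ (2 * p)"
  define cell where "cell u = PiE {1..s} (\<lambda>j. {real (u j) / 2 ^ M<..(real (u j) + 1) / 2 ^ M})" for u :: "nat \<Rightarrow> nat"
  interpret product_sigma_finite "\<lambda>_::nat. lborel :: real measure" by standard
  have fin: "finite ?\<Omega>" by (intro finite_PiE) auto
  have em: "emeasure ?M (cell u) = ennreal ((1 / 2 ^ M) ^ s)" for u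
  proof -
    have "emeasure ?M (cell u) = (\<Prod>j\<in>{1..s}. emeasure lborel {real (u j) / 2 ^ M<..(real (u j) + 1) / 2 ^ M})"
      unfolding cell_def by (rule emeasure_PiM) auto
    also have "\<dots> = (\<Prod>j\<in>{1..s}. ennreal (1 / 2 ^ M))"
      by (intro prod.cong refl, subst emeasure_lborel_Ioc) (auto simp: divide_right_mono add_divide_distrib)
    also have "\<dots> = ennreal ((1 / 2 ^ M) ^ s)"
      by (simp add: ennreal_power)
    finally show ?thesis .
  qed
  have sets: "cell u \<in> sets ?M" for u
    unfolding cell_def by (intro sets_PiM_I_finite) auto
  have "emeasure ?M (cell u) < \<infinity>" for u
    unfolding em by simp
  then have int: "integrable ?M (\<lambda>\<theta>. ?c u * indicator (cell u) \<theta>)" for u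
    by (intro integrable_mult_right integrable_real_indicator sets)
  have "measure ?M (cell u) = (1 / 2 ^ M) ^ s" for u
    unfolding measure_def em by simp
  then have "(\<integral>\<theta>. ?c u * indicator (cell u) \<theta> \<partial>?M) = ?c u * (1 / 2 ^ M) ^ s" for u
    by (simp only: integral_mult_right_zero Bochner_Integration.integral_indicator sets.Int_space_eq2[OF sets])
  then have I: "(\<integral>\<theta>. (\<Sum>u\<in>?\<Omega>. ?c u * indicator (cell u) \<theta>) \<partial>?M) = (\<Sum>u\<in>?\<Omega>. ?c u) * (1 / 2 ^ M) ^ s"
    by (subst Bochner_Integration.integral_sum[OF int]) (simp only: sum_distrib_right)
  define J where "J = (LINT \<theta>:(PiE {1..s} (\<lambda>_. {0..1}))|?M. \<bar>local_discrepancy s N x \<theta>\<bar> powr real (2 * p))"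
  have "J \<le> (\<integral>\<theta>. (\<Sum>u\<in>?\<Omega>. ?c u * indicator (cell u) \<theta>) \<partial>?M)"
    unfolding J_def set_lebesgue_integral_def
  \<comment> \<open>A non-integrable left side would have integral 0, so integrability of the
    nonnegative step function on the right suffices.\<close>
  proof (rule integral_mono')
    show "integrable ?M (\<lambda>\<theta>. \<Sum>u\<in>?\<Omega>. ?c u * indicator (cell u) \<theta>)"
      using int by (intro Bochner_Integration.integrable_sum) auto
    have c0: "?c u * indicator (cell u) \<theta> \<ge> 0" for u \<theta>
      by (intro mult_nonneg_nonneg zero_le_power) auto
    then show pos: "0 \<le> (\<Sum>u\<in>?\<Omega>. ?c u * indicator (cell u) \<theta>)" for \<theta> by (intro sum_nonneg)
    fix \<theta> :: "nat \<Rightarrow> real"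
    show "indicator (PiE {1..s} (\<lambda>_. {0..1})) \<theta> *\<^sub>R \<bar>local_discrepancy s N x \<theta>\<bar> powr real (2 * p) \<le>
        (\<Sum>u\<in>?\<Omega>. ?c u * indicator (cell u) \<theta>)"
    proof (cases "\<theta> \<in> PiE {1..s} (\<lambda>_. {0..1})")
      case False
      then show ?thesis using pos by simp
    next
      case True
      show ?thesis
      proof (cases "\<exists>j\<in>{1..s}. \<theta> j = 0")
        \<comment> \<open>Such a \<theta> lies in no cell, as the cells are open on the left, but
          its box is empty and the local discrepancy is 0.\<close>
        case z: True
        then have "{n. n < N \<and> (\<forall>j\<in>{1..s}. x n j \<in> {0..<\<theta> j})} = {}" by fastforce
        moreover have "(\<Prod>j\<in>{1..s}. \<theta> j) = 0" using z by (intro prod_zero) auto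
        ultimately have "local_discrepancy s N x \<theta> = 0"
          by (simp only: local_discrepancy_def card.empty of_nat_0 div_0 diff_self)
        then show ?thesis using pos by simp
      next
        case nz: False
        \<comment> \<open>Rounding up and subtracting 1 matches cells that contain their right end
          point.\<close>
        define u where "u = restrict (\<lambda>j. nat (\<lceil>2 ^ M * \<theta> j\<rceil> - 1)) {1..s}"
        have pos\<theta>: "0 < \<theta> j" "\<theta> j \<le> 1" if "j \<in> {1..s}" for j
          using True nz that by (force simp: PiE_iff order_less_le)+
        have uj: "real (u j) = real_of_int \<lceil>2 ^ M * \<theta> j\<rceil> - 1" if "j \<in> {1..s}" for j
        proof -
          have "1 \<le> \<lceil>2 ^ M * \<theta> j\<rceil>" using pos\<theta>[OF that] by (simp add: one_le_ceiling)
          then show ?thesis using that by (simp add: u_def)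
        qed
        have \<theta>u: "\<theta> j \<in> {real (u j) / 2 ^ M<..(real (u j) + 1) / 2 ^ M}" if "j \<in> {1..s}" for j
          using ceiling_correct[of "2 ^ M * \<theta> j"] uj[OF that]
          by (simp add: divide_less_eq le_divide_eq mult.commute)
        have u_less: "u j < 2 ^ M" if "j \<in> {1..s}" for j
        proof -
          have "real (u j) / 2 ^ M < 1"
            using \<theta>u[OF that] pos\<theta>[OF that] by (meson greaterThanAtMost_iff less_le_trans)
          then have "real (u j) < real (2 ^ M)" by simp
          then show ?thesis by (simp only: of_nat_less_iff)
        qed
        have "u \<in> ?\<Omega>" using u_less by (auto simp: u_def)
        have "\<theta> \<in> cell u" unfolding cell_def using True \<theta>u by (auto simp: PiE_iff)
        let ?d = "(real s + \<bar>grid_error s M N Y u\<bar>) / real N"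
        have "\<bar>local_discrepancy s N x \<theta>\<bar> \<le> ?d"
          by (rule local_discrepancy_le_grid_error[OF N x u_less \<theta>u])
        then have "\<bar>local_discrepancy s N x \<theta>\<bar> powr real (2 * p) \<le> ?d powr real (2 * p)"
          by (intro powr_mono2) auto
        \<comment> \<open>Positivity, ensured by the summand \<open>real s\<close>, turns the real
          power into a natural one.\<close>
        also have "?d > 0" using s N by (intro divide_pos_pos add_pos_nonneg) auto
        then have "?d powr real (2 * p) = ?c u" by (rule powr_realpow)
        also have "\<dots> = ?c u * indicator (cell u) \<theta>" using \<open>\<theta> \<in> cell u\<close> by simp
        also have "\<dots> \<le> (\<Sum>u\<in>?\<Omega>. ?c u * indicator (cell u) \<theta>)"
          using c0 fin \<open>u \<in> ?\<Omega>\<close> by (intro member_le_sum) auto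
        finally show ?thesis using True by simp
      qed
    qed
  qed
  also have "\<dots> = (\<Sum>u\<in>?\<Omega>. (real s + \<bar>grid_error s M N Y u\<bar>) ^ (2 * p)) / real N ^ (2 * p) * (1 / 2 ^ M) ^ s"
    unfolding I by (simp add: power_divide sum_divide_distrib)
  also have "\<dots> \<le> B ^ (2 * p) * real (card ?\<Omega>) / real N ^ (2 * p) * (1 / 2 ^ M) ^ s"
    by (intro mult_right_mono divide_right_mono mom) auto
  also have "\<dots> = (B / real N) ^ (2 * p)"
    by (simp add: card_PiE power_divide power_one_over)
  finally have J: "J \<le> (B / real N) ^ (2 * p)" .
  have J0: "J \<ge> 0" unfolding J_def set_lebesgue_integral_def by (intro integral_nonneg_AE) auto
  have "Lq_discrepancy s (real (2 * p)) N x = J powr (1 / real (2 * p))"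
    unfolding Lq_discrepancy_def J_def ..
  also have "\<dots> \<le> ((B / real N) ^ (2 * p)) powr (1 / real (2 * p))"
    using J J0 by (intro powr_mono2) auto
  also have "\<dots> = B / real N"
  proof (cases "B = 0")
    case False
    then have "B / real N > 0" using B N by simp
    then show ?thesis
      using p B by (simp add: powr_realpow[symmetric] powr_powr del: of_nat_mult)
  qed (use p in simp)
  finally show ?thesis .
qed


section \<open>Assembling the final bound\<close>

lemma sum_sqrt_le:
  fixes f :: "'a \<Rightarrow> real"
  assumes "\<And>i. i \<in> I \<Longrightarrow> f i \<ge> 0"
  shows "(\<Sum>i\<in>I. sqrt (f i)) \<le> sqrt (real (card I)) * sqrt (\<Sum>i\<in>I. f i)"
proof -
  have "(\<Sum>i\<in>I. 1 * sqrt (f i))\<^sup>2 \<le> (\<Sum>i\<in>I. 1\<^sup>2) * (\<Sum>i\<in>I. (sqrt (f i))\<^sup>2)"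
    by (rule Cauchy_Schwarz_ineq_sum)
  also have "(\<Sum>i\<in>I. (sqrt (f i))\<^sup>2) = (\<Sum>i\<in>I. f i)"
    using assms by (intro sum.cong) auto
  finally have "(\<Sum>i\<in>I. sqrt (f i))\<^sup>2 \<le> real (card I) * (\<Sum>i\<in>I. f i)" by simp
  then have "(\<Sum>i\<in>I. sqrt (f i)) \<le> sqrt (real (card I) * (\<Sum>i\<in>I. f i))"
    by (rule real_le_rsqrt)
  then show ?thesis by (simp add: real_sqrt_mult)
qed

text \<open>The last exponent may be 0, so \<open>m v + 1 <= 2 * m v\<close> can fail, but by strict
  decrease only at \<open>v = r\<close>. That one term is 1 and is absorbed by the sum, which is at
  least 1 because \<open>N >= 2\<close> forces \<open>m 1 >= 1\<close>.\<close>

lemma exponent_sum_bounds: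
  fixes N r :: nat and m :: "nat \<Rightarrow> nat"
  assumes N: "N \<ge> 2" "N = (\<Sum>v = 1..r. 2 ^ m v)" and m: "strict_antimono_on {1..r} m"
  shows "r \<ge> 1" and "1 \<le> (\<Sum>v = 1..r. real (m v) ^ d)"
    and "(\<Sum>v = 1..r. real (m v + 1) ^ d) \<le> (2 ^ d + 1) * (\<Sum>v = 1..r. real (m v) ^ d)"
proof -
  show r: "r \<ge> 1" using N by (cases r) auto
  have anti: "m v < m w" if "w \<in> {1..r}" "v \<in> {1..r}" "w < v" for v w
    using m that unfolding monotone_on_def by blast
  have "m 1 \<ge> 1"
  proof (rule ccontr)
    assume "\<not> m 1 \<ge> 1"
    then have "m 1 = 0" by simp
    moreover have "r = 1" using anti[of 1 2] r \<open>m 1 = 0\<close> by (cases "r \<ge> 2") auto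
    ultimately show False using N by simp
  qed
  then have "1 \<le> real (m 1) ^ d" by (intro one_le_power) simp
  also have "\<dots> \<le> (\<Sum>v = 1..r. real (m v) ^ d)"
    using r by (intro member_le_sum) auto
  finally show S: "1 \<le> (\<Sum>v = 1..r. real (m v) ^ d)" .
  have "(\<Sum>v = 1..r. real (m v + 1) ^ d) \<le> (\<Sum>v = 1..r. 2 ^ d * real (m v) ^ d + of_bool (v = r))"
  proof (rule sum_mono)
    fix v assume v: "v \<in> {1..r}"
    show "real (m v + 1) ^ d \<le> 2 ^ d * real (m v) ^ d + of_bool (v = r)"
    proof (cases "m v = 0")
      case True
      then have "v = r" using anti[of v r] v by (cases "v = r") auto
      then show ?thesis using True by simp
    next
      case False
      then have "real (m v + 1) ^ d \<le> (2 * real (m v)) ^ d" by (intro power_mono) auto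
      also have "\<dots> = 2 ^ d * real (m v) ^ d" by (rule power_mult_distrib)
      also have "\<dots> \<le> 2 ^ d * real (m v) ^ d + of_bool (v = r)" by simp
      finally show ?thesis .
    qed
  qed
  also have "\<dots> = 2 ^ d * (\<Sum>v = 1..r. real (m v) ^ d) + 1"
    using r by (simp add: sum.distrib sum_distrib_left Int_absorb1)
  finally show "(\<Sum>v = 1..r. real (m v + 1) ^ d) \<le> (2 ^ d + 1) * (\<Sum>v = 1..r. real (m v) ^ d)"
    using S by (simp add: distrib_right)
qed

theorem theorem3:
  fixes s t q :: nat
  assumes "s \<ge> 1" and "even q" and "q \<ge> 2"
  shows "\<exists>K :: real. K > 0 \<and>
    (\<forall>C. order2_digital_sequence t s C \<longrightarrow>
      (\<forall>(N :: nat) (r :: nat) (m :: nat \<Rightarrow> nat).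
        N \<ge> 2 \<longrightarrow> N = (\<Sum>v = 1..r. 2 ^ m v) \<longrightarrow> strict_antimono_on {1..r} m \<longrightarrow>
        Lq_discrepancy s (real q) N (digital_sequence C)
          \<le> K * (real r powr (3 / 2 - 1 / real q) / real N)
              * sqrt (\<Sum>v = 1..r. real (m v) ^ (s - 1))))"
proof -
  obtain p where q: "q = 2 * p" using \<open>even q\<close> by (elim evenE)
  then have p: "p \<ge> 1" using \<open>q \<ge> 2\<close> by simp
  define A where "A = \<bar>block_const s t p\<bar> + 4 ^ t"
  \<comment> \<open>\<open>real s\<close> pays for rounding to the grid; \<open>A\<close> comes from
    a single block and \<open>2 ^ (s - 1) + 1\<close> from replacing \<open>m v + 1\<close> by
    \<open>m v\<close>.\<close>
  define K where "K = real s + sqrt (A * (2 ^ (s - 1) + 1))"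
  have A: "A > 0" by (simp add: A_def add_nonneg_pos)
  have "K > 0" using \<open>s \<ge> 1\<close> A by (simp add: K_def add_pos_nonneg)
  moreover have "Lq_discrepancy s (real q) N (digital_sequence C)
      \<le> K * (real r powr (3 / 2 - 1 / real q) / real N) * sqrt (\<Sum>v = 1..r. real (m v) ^ (s - 1))"
    if seq: "order2_digital_sequence t s C" and N: "N \<ge> 2" and N_eq: "N = (\<Sum>v = 1..r. 2 ^ m v)"
      and m: "strict_antimono_on {1..r} m" for C and N r :: nat and m :: "nat \<Rightarrow> nat"
  proof -
    let ?S = "\<Sum>v = 1..r. real (m v) ^ (s - 1)"
    let ?B = "real s + (\<Sum>v = 1..r. sqrt (A * real (m v + 1) ^ (s - 1)))"
    note bounds = exponent_sum_bounds[OF N N_eq m]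
    \<comment> \<open>The grid with \<open>M = 2 * N\<close> is fine enough for the rounding and
      contains the points: for \<open>n < N\<close> only columns \<open>l < N\<close> occur, whose
      entries vanish in the rows \<open>k > 2 * N\<close>.\<close>
    have "N < 2 ^ (2 * N)"
      using less_exp[of N] power_increasing[of N "2 * N" "2 :: nat"] by linarith
    then have N_le: "real N \<le> 2 ^ (2 * N)"
      by (metis less_imp_le of_nat_le_iff of_nat_numeral of_nat_power)
    have x: "digital_sequence C n j = real (from_bits (2 * N) (digital_digit C n j)) / 2 ^ (2 * N)"
      if "n < N" "j \<in> {1..s}" for n j
    proof (rule digital_sequence_eq)
      fix k assume "k > 2 * N"
      then have "C j k l = 0" if "l \<in> {1..n}" for l
        using that \<open>n < N\<close> \<open>j \<in> {1..s}\<close> seq unfolding order2_digital_sequence_def by auto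
      then show "digital_digit C n j k = 0" unfolding digital_digit_def by (intro sum.neutral) simp
    qed
    have Lq: "Lq_discrepancy s (real (2 * p)) N (digital_sequence C) \<le> ?B / real N"
    proof (rule Lq_discrepancy_le_grid[OF p \<open>s \<ge> 1\<close> _ _ N_le x])
      show "0 \<le> ?B" using A by (auto intro!: add_nonneg_nonneg sum_nonneg)
      show "1 \<le> N" using N by simp
    qed (use grid_moment_bound[OF seq p \<open>s \<ge> 1\<close> bounds(1) N_eq m] in \<open>simp_all only: A_def\<close>)
    have "?B \<le> K * (sqrt (real r) * sqrt ?S)"
    proof -
      have "(\<Sum>v = 1..r. sqrt (A * real (m v + 1) ^ (s - 1))) \<le>
          sqrt (real (card {1..r})) * sqrt (\<Sum>v = 1..r. A * real (m v + 1) ^ (s - 1))"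
        using A by (intro sum_sqrt_le) auto
      also have "(\<Sum>v = 1..r. A * real (m v + 1) ^ (s - 1)) \<le> A * (2 ^ (s - 1) + 1) * ?S"
        using mult_left_mono[OF bounds(3)[of "s - 1"], of A] A by (simp add: sum_distrib_left mult.assoc)
      finally have "(\<Sum>v = 1..r. sqrt (A * real (m v + 1) ^ (s - 1))) \<le>
          sqrt (A * (2 ^ (s - 1) + 1)) * (sqrt (real r) * sqrt ?S)"
        by (simp add: real_sqrt_mult mult_left_mono mult.left_commute)
      \<comment> \<open>Both square roots are at least 1, so they can be attached to the rounding
        term.\<close>
      moreover have "real s * 1 \<le> real s * (sqrt (real r) * sqrt ?S)"
        using bounds(1) bounds(2)[of "s - 1"] mult_mono[of 1 "sqrt (real r)" 1 "sqrt ?S"]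
        by (intro mult_left_mono) auto
      ultimately show ?thesis unfolding K_def distrib_right by linarith
    qed
    \<comment> \<open>The exponent \<open>1 / 2\<close> is weakened here: \<open>q >= 2\<close>
      gives \<open>1 / 2 <= 3 / 2 - 1 / q\<close>, and \<open>r >= 1\<close>.\<close>
    also have "sqrt (real r) \<le> real r powr (3 / 2 - 1 / real q)"
    proof -
      have "1 / real q \<le> 1 / 2" using \<open>q \<ge> 2\<close> by (intro divide_left_mono) auto
      then have "real r powr (1 / 2) \<le> real r powr (3 / 2 - 1 / real q)"
        using bounds(1) by (intro powr_mono) auto
      then show ?thesis by (simp add: powr_half_sqrt)
    qed
    finally have "?B \<le> K * (real r powr (3 / 2 - 1 / real q) * sqrt ?S)"
      using \<open>K > 0\<close> by (simp add: mult_left_mono mult_right_mono sum_nonneg)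
    then have "?B / real N \<le> K * (real r powr (3 / 2 - 1 / real q) * sqrt ?S) / real N"
      by (rule divide_right_mono) simp
    with Lq show ?thesis
      by (simp only: q times_divide_eq_right times_divide_eq_left mult.assoc)
  qed
  ultimately show ?thesis by blast
qed

end
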